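(* For any fixed natural number $D$, any metric space induced by a connected $n$-vertex graph with diameter $D$ has $\Omega(n^{4/3})$ distinct lines (the implied constant may depend on $D$).
   Context: The metric induced by a connected graph $G$ on vertex set $V$ is $\rho(u,v)=$ length of a shortest $u$–$v$ path; the diameter is $\max_{u,v}\rho(u,v)$. For distinct points $a,b,c$ write $[abc]$ if $\rho(a,c) = \rho(a,b)+\rho(b,c)$; $\{a,b,c\}$ is collinear if one of $[abc],[bca],[cab]$ holds. For distinct $a,b$, the line $\overline{ab}$ is $\{a,b\}$ together with all $c$ such that $\{a,b,c\}$ is collinear. *)

theory Defs
  imports Complex_Main
begin

definition path_between ::
  "'a set \<Rightarrow> 'a set set \<Rightarrow> 'a \<Rightarrow> 'a list \<Rightarrow> 'a \<Rightarrow> bool" where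
  "path_between V E u p v \<longleftrightarrow>
     p \<noteq> [] \<and> hd p = u \<and> last p = v \<and> set p \<subseteq> V \<and> distinct p \<and>
     successively (\<lambda>x y. {x, y} \<in> E) p"

definition connected_graph :: "'a set \<Rightarrow> 'a set set \<Rightarrow> bool" where
  "connected_graph V E \<longleftrightarrow>
     finite V \<and> V \<noteq> {} \<and> (\<forall>e\<in>E. e \<subseteq> V \<and> card e = 2) \<and>
     (\<forall>u\<in>V. \<forall>v\<in>V. \<exists>p. path_between V E u p v)"

text \<open>A path is given by its list of vertices, so its length (number of edges) is one
  less than the length of the list.\<close>

definition graph_dist :: "'a set \<Rightarrow> 'a set set \<Rightarrow> 'a \<Rightarrow> 'a \<Rightarrow> nat" where
  "graph_dist V E u v = (LEAST k. \<exists>p. path_between V E u p v \<and> length p = Suc k)"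

definition graph_diameter :: "'a set \<Rightarrow> 'a set set \<Rightarrow> nat" where
  "graph_diameter V E = Max {graph_dist V E u v | u v. u \<in> V \<and> v \<in> V}"

definition graph_metric :: "'a set \<Rightarrow> 'a set set \<Rightarrow> 'a \<Rightarrow> 'a \<Rightarrow> real" where
  "graph_metric V E u v = real (graph_dist V E u v)"

definition metric_between :: "('a \<Rightarrow> 'a \<Rightarrow> real) \<Rightarrow> 'a \<Rightarrow> 'a \<Rightarrow> 'a \<Rightarrow> bool" where
  "metric_between \<rho> a b c \<longleftrightarrow>
     a \<noteq> b \<and> b \<noteq> c \<and> a \<noteq> c \<and> \<rho> a c = \<rho> a b + \<rho> b c"

definition metric_collinear :: "('a \<Rightarrow> 'a \<Rightarrow> real) \<Rightarrow> 'a \<Rightarrow> 'a \<Rightarrow> 'a \<Rightarrow> bool" where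
  "metric_collinear \<rho> a b c \<longleftrightarrow>
     metric_between \<rho> a b c \<or> metric_between \<rho> b c a \<or> metric_between \<rho> c a b"

definition metric_line :: "'a set \<Rightarrow> ('a \<Rightarrow> 'a \<Rightarrow> real) \<Rightarrow> 'a \<Rightarrow> 'a \<Rightarrow> 'a set" where
  "metric_line V \<rho> a b = {a, b} \<union> {c \<in> V. metric_collinear \<rho> a b c}"

definition metric_lines :: "'a set \<Rightarrow> ('a \<Rightarrow> 'a \<Rightarrow> real) \<Rightarrow> 'a set set" where
  "metric_lines V \<rho> = {metric_line V \<rho> a b | a b. a \<in> V \<and> b \<in> V \<and> a \<noteq> b}"

end

theory Submission
  imports Defs "HOL-Analysis.Convex"
begin

text \<open>With \<open>m\<close> lines on \<open>n\<close> points, \<open>n\<^sup>4 \<le> C m\<^sup>3\<close> for a constant \<open>C\<close> depending on \<open>D\<close>.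

  Fix \<open>d \<ge> 2\<close>. The \<open>k\<close> pairs at distance \<open>d\<close> that generate one given line satisfy \<open>k\<^sup>2 = O(m)\<close>: either
  many of them lie behind one another as seen from a common point, and then their far ends contain
  no collinear triple and generate quadratically many lines; or all their ends lie between the two
  ends of each pair, and then the pairs of ends from different pairs at distance at least \<open>d/2\<close>
  generate almost distinct lines. Hence the number \<open>p\<close> of pairs at distance \<open>d\<close> has \<open>p\<^sup>2 = O(m\<^sup>3)\<close>.
  This settles the case of at least \<open>n\<^sup>2/64\<close> non-adjacent pairs.

  Otherwise discard the points with more than \<open>n/32\<close> non-neighbours. Distances on the remaining set
  \<open>U\<close> are at most \<open>2\<close>, and the line of an adjacent pair \<open>a\<close>, \<open>b\<close> meets \<open>U\<close> in the symmetric
  difference of the closed non-neighbourhoods of \<open>a\<close> and \<open>b\<close>. A pair at distance \<open>2\<close> in which one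
  point has at least two twins (points of equal closed non-neighbourhood) is determined by its
  line, so if such points are frequent, then non-neighbourhoods have size \<open>O(m/n)\<close> and the adjacent
  pairs generating a given line are few. If they are rare, choose one point from each twin class;
  the adjacent pairs of chosen points generating a given line form a matching, which the lines of
  the pairs at distance \<open>2\<close> between its edges bound by \<open>O(\<surd>m)\<close>.\<close>

text \<open>Counting by fibres. The factor \<open>c\<close> expresses a fractional bound
  \<open>M / c\<close> on each fibre within the natural numbers.\<close>

lemma card_le_fibres:
  fixes c M :: nat
  assumes "finite A" "finite B" "f ` A \<subseteq> B"
    and "\<And>b. b \<in> B \<Longrightarrow> c * card {a \<in> A. f a = b} \<le> M"
  shows "c * card A \<le> M * card B"
proof -
  have "A = (\<Union>b\<in>B. {a \<in> A. f a = b})" using assms(3) by auto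
  then have "card A = card (\<Union>b\<in>B. {a \<in> A. f a = b})" by simp
  also have "\<dots> = (\<Sum>b\<in>B. card {a \<in> A. f a = b})"
    using assms(1,2) by (intro card_UN_disjoint) auto
  finally have "c * card A = (\<Sum>b\<in>B. c * card {a \<in> A. f a = b})"
    by (simp add: sum_distrib_left)
  also have "\<dots> \<le> (\<Sum>b\<in>B. M)" by (intro sum_mono assms(4))
  finally show ?thesis by (simp add: mult.commute)
qed

lemma card_pair_le: "card {p, q} \<le> 2"
  by (cases "p = q") auto

lemma card_quadruple_le: "card {a, b, c, d} \<le> 4"
  using card_length[of "[a, b, c, d]"] by simp

section \<open>Pairs generating a common line\<close>

text \<open>This isolates what the counting arguments use of a graph metric: natural-number
  distances, and by \<open>step\<close> a geodesic of unit steps between any two distinct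
  points.\<close>

locale geodesic_space =
  fixes V :: "'a set" and \<delta> :: "'a \<Rightarrow> 'a \<Rightarrow> nat"
  assumes finV: "finite V"
    and zero: "x \<in> V \<Longrightarrow> y \<in> V \<Longrightarrow> \<delta> x y = 0 \<longleftrightarrow> x = y"
    and sym: "\<delta> x y = \<delta> y x"
    and tri: "x \<in> V \<Longrightarrow> y \<in> V \<Longrightarrow> z \<in> V \<Longrightarrow> \<delta> x z \<le> \<delta> x y + \<delta> y z"
    and step: "x \<in> V \<Longrightarrow> y \<in> V \<Longrightarrow> x \<noteq> y \<Longrightarrow> \<exists>u\<in>V. \<delta> x u = 1 \<and> \<delta> x y = 1 + \<delta> u y"
begin

abbreviation line :: "'a \<Rightarrow> 'a \<Rightarrow> 'a set" where
  "line a b \<equiv> metric_line V (\<lambda>x y. real (\<delta> x y)) a b"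

abbreviation lines :: "'a set set" where
  "lines \<equiv> metric_lines V (\<lambda>x y. real (\<delta> x y))"

lemma refl0: "x \<in> V \<Longrightarrow> \<delta> x x = 0"
  using zero by blast

text \<open>Allowing \<open>c\<close> to coincide with \<open>a\<close> or \<open>b\<close> in the three equations is what adds the two
  generating points to the line.\<close>

lemma mem_line:
  assumes "a \<in> V" "b \<in> V" "a \<noteq> b"
  shows "c \<in> line a b \<longleftrightarrow> c \<in> V \<and>
    (\<delta> a b = \<delta> a c + \<delta> c b \<or> \<delta> a c = \<delta> a b + \<delta> b c \<or> \<delta> c b = \<delta> c a + \<delta> a b)"
proof (cases "c = a \<or> c = b")
  case True
  then show ?thesis using assms by (auto simp: metric_line_def refl0)
next
  case False
  have *: "real x = real y + real z \<longleftrightarrow> x = y + z" for x y z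
    by linarith
  show ?thesis
    using False assms sym[of a b] sym[of b c] sym[of a c]
    by (auto simp: metric_line_def metric_collinear_def metric_between_def *)
qed

lemma line_subset: "a \<in> V \<Longrightarrow> b \<in> V \<Longrightarrow> line a b \<subseteq> V"
  by (auto simp: metric_line_def)

lemma line_commute:
  assumes "a \<in> V" "b \<in> V" shows "line a b = line b a"
proof (cases "a = b")
  case False
  show ?thesis
  proof (rule set_eqI)
    fix c
    show "c \<in> line a b \<longleftrightarrow> c \<in> line b a"
      using False assms sym[of a b] sym[of b c] sym[of a c]
      by (auto simp: mem_line)
  qed
qed simp

lemma line_in_lines: "a \<in> V \<Longrightarrow> b \<in> V \<Longrightarrow> a \<noteq> b \<Longrightarrow> line a b \<in> lines"
  by (auto simp: metric_lines_def)

lemma ends_in_line: "a \<in> V \<Longrightarrow> b \<in> V \<Longrightarrow> a \<in> line a b" "a \<in> V \<Longrightarrow> b \<in> V \<Longrightarrow> b \<in> line a b"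
  by (auto simp: metric_line_def)

lemma finite_lines: "finite lines"
proof (rule finite_subset)
  show "lines \<subseteq> Pow V" using line_subset by (auto simp: metric_lines_def)
qed (use finV in simp)

text \<open>A line generated by two points of \<open>W\<close> meets \<open>W\<close> only in these
  two, so it comes from at most two ordered pairs.\<close>

lemma no_collinear_triple_lines:
  assumes W: "W \<subseteq> V"
    and nc: "\<And>a b c. \<lbrakk>a \<in> W; b \<in> W; c \<in> W; a \<noteq> b; a \<noteq> c; b \<noteq> c\<rbrakk> \<Longrightarrow> c \<notin> line a b"
  shows "card W * (card W - 1) \<le> 2 * card lines"
proof -
  have fW: "finite W" using W finV finite_subset by blast
  define A where "A = Sigma W (\<lambda>a. W - {a})"
  have "1 * card A \<le> 2 * card lines"
  proof (rule card_le_fibres[where f = "\<lambda>(a,b). line a b"])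
    show "finite A" using fW by (simp add: A_def)
    show "(\<lambda>(a, b). line a b) ` A \<subseteq> lines"
      using W by (auto simp: A_def intro!: line_in_lines)
  next
    fix L
    show "1 * card {p \<in> A. (case p of (a, b) \<Rightarrow> line a b) = L} \<le> 2"
    proof (cases "\<exists>a b. (a,b) \<in> A \<and> line a b = L")
      case True
      then obtain a b where ab: "(a,b) \<in> A" "line a b = L" by auto
      have "L \<inter> W \<subseteq> {a,b}" using nc[of a b] ab by (auto simp: A_def)
      have "{p \<in> A. (case p of (a, b) \<Rightarrow> line a b) = L} \<subseteq> {(a,b),(b,a)}"
      proof
        fix p assume "p \<in> {p \<in> A. (case p of (a, b) \<Rightarrow> line a b) = L}"
        then obtain x y where p: "p = (x, y)" "x \<in> W" "y \<in> W" "x \<noteq> y" "line x y = L"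
          by (auto simp: A_def)
        then have "x \<in> L \<inter> W" "y \<in> L \<inter> W" using W ends_in_line[of x y] by auto
        then have "x \<in> {a, b}" "y \<in> {a, b}" using \<open>L \<inter> W \<subseteq> {a,b}\<close> by blast+
        then show "p \<in> {(a,b),(b,a)}" using p by auto
      qed
      then have "card {p \<in> A. (case p of (a, b) \<Rightarrow> line a b) = L} \<le> card {(a,b),(b,a)}"
        by (intro card_mono) auto
      also have "\<dots> \<le> 2" by (rule card_pair_le)
      finally show ?thesis by simp
    next
      case False
      then have empty: "{p \<in> A. (case p of (a, b) \<Rightarrow> line a b) = L} = {}" by auto
      show ?thesis unfolding empty by simp
    qed
  qed (rule finite_lines)
  moreover have "card A = card W * (card W - 1)"
    using fW by (simp add: A_def)
  ultimately show ?thesis by simp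
qed

section \<open>Pairs lying behind one another as seen from a common point\<close>

text \<open>Since \<open>v\<close> differs from \<open>z\<close>, the distance from
  \<open>v'\<close> to \<open>w\<close> is at least \<open>\<delta> z w\<close>, so
  \<open>v'\<close> can lie between \<open>z\<close> and \<open>w\<close> only as \<open>z\<close>
  itself. Lying beyond \<open>w\<close> would change the difference of the distances to
  \<open>w\<close> and \<open>z\<close> by \<open>2 * \<delta> z w\<close>, but one step changes it
  by at most 2.\<close>

lemma behind_step:
  assumes V: "z \<in> V" "w \<in> V" "v \<in> V" "v' \<in> V"
    and d: "2 \<le> \<delta> z w" and adj: "\<delta> v v' = 1" and L: "v' \<in> line z w"
    and b: "\<delta> v w = \<delta> v z + \<delta> z w" and vz: "v \<noteq> z"
  shows "\<delta> v' w = \<delta> v' z + \<delta> z w"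
proof -
  have zw: "z \<noteq> w" using d V refl0 by auto
  have "\<delta> v z \<noteq> 0" using vz zero V by blast
  moreover have "\<delta> v w \<le> \<delta> v v' + \<delta> v' w" "\<delta> v' z \<le> \<delta> v' v + \<delta> v z"
    using tri V by auto
  ultimately show ?thesis
    using L[unfolded mem_line[OF V(1,2) zw]] d adj b sym[of v' v] sym[of z v'] sym[of w v']
    by auto
qed

text \<open>The sign of \<open>\<delta> v w - \<delta> v z\<close> cannot jump from \<open>\<delta> z w \<ge> 2\<close> to its negative in one step:
  a geodesic inside the line that leaves the side of \<open>z\<close> has to pass through \<open>z\<close>.\<close>

lemma behind_path:
  assumes V: "z \<in> V" "w \<in> V" "p \<in> V" "q \<in> V" and d: "2 \<le> \<delta> z w"
    and I: "\<And>v. v \<in> V \<Longrightarrow> \<delta> p v + \<delta> v q = \<delta> p q \<Longrightarrow> v \<in> line z w"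
    and b: "\<delta> p w = \<delta> p z + \<delta> z w"
  shows "\<delta> q w = \<delta> q z + \<delta> z w \<or> (\<delta> p z + \<delta> z q = \<delta> p q \<and> z \<noteq> q)"
  using V(3) I b
proof (induction "\<delta> p q" arbitrary: p)
  case 0
  then show ?case using V zero by metis
next
  case (Suc n)
  have pq: "p \<noteq> q" using Suc.hyps(2) Suc.prems(1) refl0 by auto
  show ?case
  proof (cases "p = z")
    case True
    then show ?thesis using pq Suc.prems(1) refl0 by auto
  next
    case False
    obtain u where u: "u \<in> V" "\<delta> p u = 1" "\<delta> p q = 1 + \<delta> u q"
      using step[OF Suc.prems(1) V(4) pq] by blast
    \<comment> \<open>The interval from \<open>u\<close> to \<open>q\<close> lies inside the one
      from \<open>p\<close> to \<open>q\<close>, so the hypothesis on the line is inherited.\<close>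
    have sub: "\<delta> p v + \<delta> v q = \<delta> p q" if "v \<in> V" "\<delta> u v + \<delta> v q = \<delta> u q" for v
      using tri[OF Suc.prems(1) u(1) that(1)] tri[OF Suc.prems(1) that(1) V(4)] u that by linarith
    have uL: "u \<in> line z w" using Suc.prems(2)[OF u(1)] u by simp
    have ub: "\<delta> u w = \<delta> u z + \<delta> z w"
      by (rule behind_step[OF V(1,2) Suc.prems(1) u(1) d u(2) uL Suc.prems(3) False])
    have "\<delta> q w = \<delta> q z + \<delta> z w \<or> (\<delta> u z + \<delta> z q = \<delta> u q \<and> z \<noteq> q)"
      using Suc.hyps(1)[of u] Suc.hyps(2) u ub Suc.prems(2) sub by auto
    then show ?thesis using sub[OF V(1)] by blast
  qed
qed

text \<open>A geodesic from \<open>o'\<close> to \<open>z'\<close>, continued to \<open>w'\<close>,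
  stays in the line and starts behind \<open>z\<close>. By \<open>behind_path\<close> it remains
  behind \<open>z\<close> unless it passes through \<open>z\<close>, and the equal levels
  \<open>h\<close> allow that only if \<open>z = z'\<close>.\<close>

lemma bundle_behind:
  assumes V: "z \<in> V" "w \<in> V" "z' \<in> V" "w' \<in> V" "o' \<in> V"
    and d: "2 \<le> d" "\<delta> z w = d" "\<delta> z' w' = d" and L: "line z w = line z' w'"
    and h: "\<delta> o' z = h" "\<delta> o' z' = h" "\<delta> o' w = h + d" "\<delta> o' w' = h + d"
    and ne: "(z, w) \<noteq> (z', w')"
  shows "\<delta> z' w = \<delta> z' z + d \<and> \<delta> w' w = \<delta> w' z + d"
proof -
  have ne': "z' \<noteq> w'" using d V refl0 by auto
  have d': "2 \<le> \<delta> z w" using d by simp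
  have "\<delta> z' w = \<delta> z' z + \<delta> z w \<or> (\<delta> o' z + \<delta> z z' = \<delta> o' z' \<and> z \<noteq> z')"
  proof (rule behind_path[OF V(1,2,5,3) d'])
    fix v assume v: "v \<in> V" "\<delta> o' v + \<delta> v z' = \<delta> o' z'"
    have "\<delta> v w' = \<delta> v z' + \<delta> z' w'"
      using tri[OF V(5) v(1) V(4)] tri[OF v(1) V(3,4)] v h d by linarith
    then show "v \<in> line z w" unfolding L using V v ne' by (simp add: mem_line)
  qed (use h d in simp)
  then have 1: "\<delta> z' w = \<delta> z' z + d"
    using h d V zero[of z z'] by auto
  have "\<delta> w' w = \<delta> w' z + \<delta> z w \<or> (\<delta> z' z + \<delta> z w' = \<delta> z' w' \<and> z \<noteq> w')"
  proof (rule behind_path[OF V(1,2,3,4) d'])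
    fix v assume v: "v \<in> V" "\<delta> z' v + \<delta> v w' = \<delta> z' w'"
    then show "v \<in> line z w" unfolding L using V v ne' by (simp add: mem_line)
  qed (use 1 d in simp)
  moreover have "\<delta> w' w = \<delta> w' z + d" if *: "\<delta> z' z + \<delta> z w' = \<delta> z' w'"
  proof -
    have "\<delta> z' z = 0" using tri[OF V(5,1,4)] * h d by linarith
    then have zz: "z' = z" using zero V by blast
    have zw: "z \<noteq> w" using d V refl0 by auto
    \<comment> \<open>Here \<open>w\<close> and \<open>w'\<close> are different points of the line
      at the same distance \<open>d\<close> from \<open>z\<close>, so they lie on opposite sides of
      \<open>z\<close>.\<close>
    have "w' \<in> line z w" using L ends_in_line V by auto
    moreover have "\<delta> w w' \<noteq> 0" using ne zz V zero by blast
    ultimately show ?thesis using mem_line[OF V(1,2) zw, of w'] zz d sym[of w' w] sym[of w' z]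
      by auto
  qed
  ultimately show ?thesis using 1 d by blast
qed

text \<open>\<open>bundle_behind\<close> places \<open>z\<close> between \<open>w'\<close> and
  \<open>w\<close>, and with the two pairs exchanged it places \<open>z'\<close> between
  \<open>z\<close> and \<open>w'\<close>.\<close>

lemma bundle_dist:
  assumes V: "z \<in> V" "w \<in> V" "z' \<in> V" "w' \<in> V" "o' \<in> V"
    and d: "2 \<le> d" "\<delta> z w = d" "\<delta> z' w' = d" and L: "line z w = line z' w'"
    and h: "\<delta> o' z = h" "\<delta> o' z' = h" "\<delta> o' w = h + d" "\<delta> o' w' = h + d"
    and ne: "(z, w) \<noteq> (z', w')"
  shows "\<delta> w w' = \<delta> z z' + 2 * d"
  using bundle_behind[OF V d L h ne]
    bundle_behind[OF V(3,4,1,2,5) d(1,3,2) L[symmetric] h(2,1,4,3) ne[symmetric]]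
    sym[of w w'] sym[of z w'] sym[of z z'] by linarith

text \<open>Distances between far ends exceed those between near ends by the constant
  \<open>2 * d\<close>. This makes every triangle inequality among far ends strict, so no three of
  them are collinear. The \<open>+ 1\<close> covers a single pair.\<close>

lemma bundle_card:
  assumes d: "2 \<le> d" and o': "o' \<in> V"
    and F: "F \<subseteq> {(z, w). z \<in> V \<and> w \<in> V \<and> \<delta> z w = d \<and> line z w = L \<and>
        \<delta> o' z = h \<and> \<delta> o' w = h + d}"
  shows "card F ^ 2 \<le> 4 * card lines + 1"
proof -
  have Fp: "z \<in> V" "w \<in> V" "\<delta> z w = d" "line z w = L" "\<delta> o' z = h" "\<delta> o' w = h + d"
    if "(z, w) \<in> F" for z w using F that by auto
  have ww: "\<delta> w w' = \<delta> z z' + 2 * d"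
    if "(z, w) \<in> F" "(z', w') \<in> F" "(z, w) \<noteq> (z', w')" for z w z' w'
    using bundle_dist[OF Fp(1,2)[OF that(1)] Fp(1,2)[OF that(2)] o' d Fp(3)[OF that(1)]
        Fp(3)[OF that(2)], of h] Fp(4-6)[OF that(1)] Fp(4-6)[OF that(2)] that(3) by auto
  have inj: "inj_on snd F"
  proof (rule inj_onI)
    fix p q assume pq: "p \<in> F" "q \<in> F" "snd p = snd q"
    show "p = q"
    proof (rule ccontr)
      assume "p \<noteq> q"
      then have "\<delta> (snd p) (snd q) = \<delta> (fst p) (fst q) + 2 * d"
        using ww[of "fst p" "snd p" "fst q" "snd q"] pq by (metis prod.collapse)
      then show False using pq d refl0[of "snd q"] Fp(2)[of "fst q" "snd q"] by simp
    qed
  qed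
  have "card (snd ` F) * (card (snd ` F) - 1) \<le> 2 * card lines"
  proof (rule no_collinear_triple_lines)
    show "snd ` F \<subseteq> V" using F by auto
  next
    fix a b c assume "a \<in> snd ` F" "b \<in> snd ` F" "c \<in> snd ` F" and ne: "a \<noteq> b" "a \<noteq> c" "b \<noteq> c"
    then obtain a' b' c' where m: "(a', a) \<in> F" "(b', b) \<in> F" "(c', c) \<in> F" by auto
    note ds = ww[OF m(1,2)] ww[OF m(2,1)] ww[OF m(1,3)] ww[OF m(3,1)] ww[OF m(2,3)] ww[OF m(3,2)]
    note vs = Fp(1)[OF m(1)] Fp(1)[OF m(2)] Fp(1)[OF m(3)]
    have t: "\<delta> a' b' \<le> \<delta> a' c' + \<delta> c' b'" "\<delta> a' c' \<le> \<delta> a' b' + \<delta> b' c'" "\<delta> c' b' \<le> \<delta> c' a' + \<delta> a' b'"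
      using tri vs by auto
    have "\<not> (\<delta> a b = \<delta> a c + \<delta> c b \<or> \<delta> a c = \<delta> a b + \<delta> b c \<or> \<delta> c b = \<delta> c a + \<delta> a b)"
      using ds ne t d by auto
    then show "c \<notin> line a b" using mem_line[OF Fp(2)[OF m(1)] Fp(2)[OF m(2)] ne(1)] by blast
  qed
  then have "card F * (card F - 1) \<le> 2 * card lines" using card_image[OF inj] by simp
  then show ?thesis
  proof (cases "card F \<le> 1")
    case True
    then show ?thesis by (cases "card F") (auto simp: power2_eq_square)
  next
    case False
    then have "card F * card F \<le> card F * (2 * (card F - 1))" by (intro mult_le_mono) auto
    then show ?thesis using \<open>card F * (card F - 1) \<le> 2 * card lines\<close>
      by (simp add: power2_eq_square algebra_simps)
  qed
qed

text \<open>A neighbour of \<open>x\<close> on a geodesic from \<open>x\<close> to \<open>y\<close> lies on the first line but not on the second.\<close>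

lemma side_rectangle_lines_differ:
  assumes V: "x \<in> V" "y \<in> V" "z \<in> V" "w \<in> V"
    and a: "2 \<le> a" "\<delta> x y = a" "\<delta> z w = a"
    and p: "0 < p" "\<delta> x z = p" "\<delta> y w = p" "\<delta> x w = p + a" "\<delta> y z = p + a"
  shows "line x y \<noteq> line z w"
proof
  assume L: "line x y = line z w"
  have ne: "x \<noteq> y" "z \<noteq> w" using a V refl0 by auto
  obtain u where u: "u \<in> V" "\<delta> x u = 1" "\<delta> x y = 1 + \<delta> u y" using step V ne by blast
  have "u \<in> line x y" using u V ne by (simp add: mem_line)
  moreover have "\<delta> y z \<le> \<delta> y u + \<delta> u z" "\<delta> u z \<le> \<delta> u x + \<delta> x z"
    "\<delta> x w \<le> \<delta> x u + \<delta> u w" "\<delta> u w \<le> \<delta> u y + \<delta> y w"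
    by (blast intro: tri V u(1))+
  ultimately show False
    using a p u(2,3) sym[of y u] sym[of x u] sym[of z u] sym[of w u] unfolding L mem_line[OF V(3,4) ne(2)]
    by auto
qed

section \<open>One pair nested inside another\<close>

text \<open>The point \<open>x\<close> is on the line of \<open>s\<close>, \<open>t\<close> and
  closer than \<open>d\<close> to both, hence between them. For \<open>w\<close> strictly behind
  \<open>x\<close> both distances grow by \<open>\<delta> w x\<close>: their sum exceeds
  \<open>d\<close> while their difference stays below \<open>d\<close>, so \<open>w\<close> is off
  the line.\<close>

lemma inside_pair_between_aux:
  assumes V: "x \<in> V" "y \<in> V" "s \<in> V" "t \<in> V" "w \<in> V"
    and d: "\<delta> x y = d" "\<delta> s t = d" and L: "line x y = line s t" "w \<in> line x y"
    and s: "\<delta> x s + \<delta> s y = d" "s \<noteq> x" "s \<noteq> y"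
    and t: "\<delta> x t + \<delta> t y = d" "t \<noteq> x" "t \<noteq> y"
    and b: "\<delta> w y = \<delta> w x + d"
  shows "w = x"
proof (rule ccontr)
  assume "w \<noteq> x"
  then have pos: "\<delta> w x > 0" "\<delta> x s > 0" "\<delta> s y > 0" "\<delta> x t > 0" "\<delta> t y > 0"
    using zero V s t by (metis neq0_conv)+
  then have st: "s \<noteq> t" using d s V refl0 by auto
  have "x \<in> line s t" using L ends_in_line V by auto
  then have xst: "\<delta> x s + \<delta> x t = d"
    using mem_line[OF V(3,4) st, of x] pos s t d sym[of x s] sym[of x t] by auto
  have ws: "\<delta> w s = \<delta> w x + \<delta> x s" using tri[OF V(5,3,2)] tri[OF V(5,1,3)] b s by linarith
  have wt: "\<delta> w t = \<delta> w x + \<delta> x t" using tri[OF V(5,4,2)] tri[OF V(5,1,4)] b t by linarith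
  have "w \<in> line s t" using L by simp
  then show False
    using mem_line[OF V(3,4) st, of w] ws wt xst d pos sym[of w s] sym[of w t] by auto
qed

lemma inside_pair_between:
  assumes V: "x \<in> V" "y \<in> V" "s \<in> V" "t \<in> V" "w \<in> V"
    and d: "\<delta> x y = d" "\<delta> s t = d" and L: "line x y = line s t" "w \<in> line x y"
    and s: "\<delta> x s + \<delta> s y = d" "s \<noteq> x" "s \<noteq> y"
    and t: "\<delta> x t + \<delta> t y = d" "t \<noteq> x" "t \<noteq> y"
  shows "\<delta> x w + \<delta> w y = d"
proof -
  have "\<delta> x s > 0" using zero V s by (metis neq0_conv)
  then have xy: "x \<noteq> y" using s d V refl0 by auto
  have 1: "w = x" if "\<delta> w y = \<delta> w x + d"
    using inside_pair_between_aux[OF V d L s t that] .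
  have 2: "w = y" if "\<delta> w x = \<delta> w y + d"
  proof (rule inside_pair_between_aux[OF V(2,1,3,4,5) _ d(2) _ _ _ s(3,2) _ t(3,2) that])
    show "\<delta> y x = d" using d sym by simp
    show "line y x = line s t" "w \<in> line y x" using L line_commute V by auto
    show "\<delta> y s + \<delta> s x = d" "\<delta> y t + \<delta> t x = d"
      using s t sym[of y s] sym[of y t] sym[of s x] sym[of t x] by simp_all
  qed
  show ?thesis
    using L(2)[unfolded mem_line[OF V(1,2) xy]] 1 2 d V sym[of w x] sym[of w y] refl0 by auto
qed

text \<open>A single nested pair puts all of \<open>L\<close> between \<open>x\<close> and
  \<open>y\<close>. Any pair of \<open>F\<close> then has the ends \<open>x\<close>,
  \<open>y\<close> or is itself nested inside them; in the latter case \<open>x\<close> and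
  \<open>y\<close> are also nested inside that pair, and \<open>inside_pair_between\<close> applies
  with the roles exchanged.\<close>

lemma one_inside_all_between:
  assumes F: "F = {(a, b). a \<in> V \<and> b \<in> V \<and> \<delta> a b = d \<and> line a b = L}"
    and xy: "(x, y) \<in> F" and st: "(s, t) \<in> F"
    and s: "\<delta> x s + \<delta> s y = d" "s \<noteq> x" "s \<noteq> y"
    and t: "\<delta> x t + \<delta> t y = d" "t \<noteq> x" "t \<noteq> y"
    and pq: "(p, q) \<in> F" and v: "v \<in> L"
  shows "\<delta> p v + \<delta> v q = d"
proof -
  have V: "x \<in> V" "y \<in> V" "s \<in> V" "t \<in> V" "p \<in> V" "q \<in> V"
    and d: "\<delta> x y = d" "\<delta> s t = d" "\<delta> p q = d"
    and L: "line x y = L" "line s t = L" "line p q = L"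
    using F xy st pq by auto
  have btw: "\<delta> x u + \<delta> u y = d" if "u \<in> L" for u
    using inside_pair_between[OF V(1-4) _ d(1,2) _ _ s t] that L line_subset[OF V(1,2)] by auto
  have vV: "v \<in> V" using v L line_subset V by blast
  have pqL: "p \<in> L" "q \<in> L" using L ends_in_line V by auto
  note pb = btw[OF pqL(1)] and qb = btw[OF pqL(2)]
  have q0: "q = y" if "p = x" using that qb d zero V by auto
  have q1: "q = x" if "p = y" using that qb d zero V sym[of q y] by auto
  have p0: "p = x \<or> p = y" if "q = x \<or> q = y"
    using that pb d zero V sym[of p x] sym[of p y] by auto
  show ?thesis
  proof (cases "p = x \<or> p = y")
    case True
    then show ?thesis using q0 q1 btw[OF v] sym[of x v] sym[of y v] by auto
  next
    case False
    then have ne: "p \<noteq> x" "p \<noteq> y" "q \<noteq> x" "q \<noteq> y" using p0 by auto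
    then have pos: "\<delta> p x > 0" "\<delta> p y > 0" "\<delta> q x > 0" "\<delta> q y > 0"
      using zero V by (metis neq0_conv)+
    then have pq': "p \<noteq> q" using d pb V refl0 sym[of p x] by auto
    have "x \<in> line p q" "y \<in> line p q" using L ends_in_line V by auto
    then have "\<delta> p x + \<delta> x q = d" "\<delta> p y + \<delta> y q = d"
      using mem_line[OF V(5,6) pq', of x] mem_line[OF V(5,6) pq', of y] pos pb qb d
        sym[of x p] sym[of y p] sym[of x q] sym[of y q] by auto
    then show ?thesis
      using inside_pair_between[OF V(5,6,1,2) vV d(3,1)] L v ne by auto
  qed
qed

end

section \<open>Antipodal families\<close>

text \<open>\<open>X\<close> models the ends of the pairs at distance \<open>d\<close> generating
  one line, when every end lies between the two ends of each pair; \<open>bar\<close> takes an end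
  to its partner.\<close>

locale antipodal_family = geodesic_space +
  fixes X :: "'a set" and bar :: "'a \<Rightarrow> 'a" and d :: nat
  assumes XV: "X \<subseteq> V"
    and d0: "0 < d"
    and barX: "P \<in> X \<Longrightarrow> bar P \<in> X"
    and barbar: "P \<in> X \<Longrightarrow> bar (bar P) = P"
    and bar_dist: "P \<in> X \<Longrightarrow> \<delta> P (bar P) = d"
    and split: "P \<in> X \<Longrightarrow> Q \<in> X \<Longrightarrow> \<delta> P Q + \<delta> Q (bar P) = d"
begin

lemma inV: "P \<in> X \<Longrightarrow> P \<in> V" "P \<in> X \<Longrightarrow> bar P \<in> V"
  using XV barX by auto

lemma dist_less: "P \<in> X \<Longrightarrow> Q \<in> X \<Longrightarrow> Q \<noteq> bar P \<Longrightarrow> \<delta> P Q < d"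
  using split[of P Q] zero[of Q "bar P"] inV by (metis add.right_neutral less_add_same_cancel1 neq0_conv)

text \<open>Replacing \<open>R\<close> by \<open>bar R\<close> turns each distance into its
  complement to \<open>d\<close>. For \<open>R\<close> strictly between \<open>P\<close> and
  \<open>Q\<close>, the distances from \<open>bar R\<close> would have sum
  \<open>2 * d - \<delta> P Q\<close>, more than \<open>\<delta> P Q\<close>, and difference less
  than \<open>\<delta> P Q\<close>, so \<open>bar R\<close> would be off the line.\<close>

lemma full_pair_beyond:
  assumes X: "P \<in> X" "Q \<in> X" "R \<in> X" and ne: "P \<noteq> Q" "Q \<noteq> bar P"
    and R: "R \<in> line P Q" "bar R \<in> line P Q"
  shows "\<delta> R Q = \<delta> R P + \<delta> P Q \<or> \<delta> R P = \<delta> R Q + \<delta> P Q"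
  using R mem_line[OF inV(1)[OF X(1)] inV(1)[OF X(2)] ne(1), of R]
    mem_line[OF inV(1)[OF X(1)] inV(1)[OF X(2)] ne(1), of "bar R"]
    split[OF X(3,1)] split[OF X(3,2)] dist_less[OF X(1,2) ne(2)]
    sym[of P R] sym[of Q R] sym[of P "bar R"] sym[of Q "bar R"]
  by auto

text \<open>If \<open>P'\<close> is behind \<open>P\<close>, the four points are forced into the
  configuration that \<open>side_rectangle_lines_differ\<close> excludes;
  \<open>d \<le> 2 * a\<close> discards the other positions of \<open>Q'\<close>.\<close>

lemma long_lines_differ_aux:
  assumes X: "P \<in> X" "Q \<in> X" "P' \<in> X" "Q' \<in> X"
    and ne: "P \<noteq> Q" "Q \<noteq> bar P" "P' \<noteq> Q'" "Q' \<noteq> bar P'"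
    and a: "\<delta> P Q = a" "\<delta> P' Q' = a" "d \<le> 2 * a" and L: "line P Q = line P' Q'"
    and P': "P' \<notin> {P, bar P, Q, bar Q}" and e: "\<delta> P' Q = \<delta> P' P + a"
  shows False
proof -
  note V = inV(1)[OF X(1)] inV(1)[OF X(2)] inV(1)[OF X(3)] inV(1)[OF X(4)]
  have e0: "0 < \<delta> P' P" using P' zero V by (metis insertCI neq0_conv)
  have "\<delta> P' Q < d" using dist_less[OF X(2,3)] P' sym[of P' Q] by simp
  then have ed: "\<delta> P' P + a < d" using e by simp
  have Q': "Q' \<notin> {P, bar P, Q, bar Q}"
    using split[OF X(1,3)] split[OF X(2,3)] e e0 ed a sym[of P P'] sym[of Q P'] by auto
  \<comment> \<open>\<open>S\<close> lies between \<open>R\<close> and \<open>bar R\<close>, and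
    \<open>R\<close> between \<open>S\<close> and \<open>bar S\<close>.\<close>
  have full': "bar R \<in> line R S" "bar S \<in> line R S" if "R \<in> X" "S \<in> X" "R \<noteq> S" for R S
    using split[OF that(1,2)] split[OF that(2,1)] bar_dist that inV
      sym[of "bar R" S] sym[of "bar R" R] sym[of "bar S" R] sym[of S R] sym[of S "bar S"]
    by (auto simp: mem_line)
  have "P \<in> line P' Q'" "bar P \<in> line P' Q'" "Q' \<in> line P Q" "bar Q' \<in> line P Q"
    using L ends_in_line V full' X ne by metis+
  then have 1: "\<delta> P Q' = \<delta> P P' + a \<or> \<delta> P P' = \<delta> P Q' + a"
    and 2: "\<delta> Q' Q = \<delta> Q' P + a \<or> \<delta> Q' P = \<delta> Q' Q + a"
    using full_pair_beyond[OF X(3,4,1) ne(3,4)] full_pair_beyond[OF X(1,2,4) ne(1,2)] a by auto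
  have 3: "\<delta> P Q' = \<delta> P' P + a" using 1 ed a sym[of P P'] by auto
  have "\<delta> Q Q' \<le> d" using split[OF X(2,4)] by simp
  then have 4: "\<delta> Q Q' = \<delta> P' P" using 2 3 a e0 sym[of Q Q'] sym[of P Q'] by auto
  have "2 \<le> a" using ed e0 a by linarith
  then show False
    using side_rectangle_lines_differ[OF V _ a(1,2) e0 sym 4 3] L e sym[of P' Q] by auto
qed

text \<open>Both \<open>P'\<close> and \<open>bar P'\<close> are on the line, so \<open>P'\<close>
  is behind \<open>P\<close> or behind \<open>Q\<close>; exchanging \<open>P\<close> and
  \<open>Q\<close> turns the second case into the first.\<close>

lemma long_lines_differ:
  assumes X: "P \<in> X" "Q \<in> X" "P' \<in> X" "Q' \<in> X"
    and ne: "P \<noteq> Q" "Q \<noteq> bar P" "P' \<noteq> Q'" "Q' \<noteq> bar P'"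
    and a: "\<delta> P Q = a" "\<delta> P' Q' = a" "d \<le> 2 * a" and L: "line P Q = line P' Q'"
  shows "P' \<in> {P, bar P, Q, bar Q}"
proof (rule ccontr)
  assume P': "P' \<notin> {P, bar P, Q, bar Q}"
  note V = inV(1)[OF X(1)] inV(1)[OF X(2)] inV(1)[OF X(3)] inV(1)[OF X(4)]
  have "bar P' \<in> line P' Q'"
    using split[OF X(3,4)] bar_dist[OF X(3)] V inV ne X by (auto simp: mem_line)
  then have "\<delta> P' Q = \<delta> P' P + a \<or> \<delta> P' P = \<delta> P' Q + a"
    using full_pair_beyond[OF X(1-3) ne(1,2)] ends_in_line[of P' Q'] V L a by auto
  moreover have "\<not> \<delta> P' Q = \<delta> P' P + a"
    using long_lines_differ_aux[OF X ne a L P'] by blast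
  moreover have "\<not> \<delta> P' P = \<delta> P' Q + a"
  proof -
    have "P \<noteq> bar Q" using ne barbar X by auto
    then show ?thesis
      using long_lines_differ_aux[OF X(2,1,3,4) ne(1)[symmetric] _ ne(3,4) _ a(2,3)] a L
        line_commute V P' sym[of Q P] by auto
  qed
  ultimately show False by blast
qed

text \<open>One of \<open>Q\<close>, \<open>bar Q\<close> is at distance at least
  \<open>d / 2\<close> from \<open>P\<close>, so about half of the ordered pairs are long. The
  length, with fewer than \<open>d + 1\<close> possible values, and the line leave at most
  \<open>4 * 4\<close> ordered pairs.\<close>

lemma antipodal_card: "card X * (card X - 2) \<le> 32 * d * card lines"
proof -
  have fX: "finite X" using XV finV finite_subset by blast
  define B where "B P = X - {P, bar P}" for P
  define G where "G P = {Q \<in> B P. d \<le> 2 * \<delta> P Q}" for P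
  define A where "A = Sigma X G"
  have fG: "finite (G P)" for P using fX by (simp add: G_def B_def)
  have "card X - 2 \<le> 2 * card (G P)" if P: "P \<in> X" for P
  proof -
    have "P \<noteq> bar P" using bar_dist[OF P] d0 refl0 inV P by force
    then have "card X - 2 = card (B P)" using P barX fX by (simp add: B_def)
    also have "B P \<subseteq> G P \<union> bar ` G P"
    proof
      fix Q assume Q: "Q \<in> B P"
      then have QX: "Q \<in> X" "Q \<noteq> P" "Q \<noteq> bar P" by (auto simp: B_def)
      have "bar Q \<noteq> bar P" using QX P barbar by metis
      then have "bar Q \<in> B P" using QX barX barbar P by (auto simp: B_def)
      moreover have "\<delta> Q P + \<delta> P (bar Q) = d" using split QX P by blast
      then have "d \<le> 2 * \<delta> P Q \<or> d \<le> 2 * \<delta> P (bar Q)" using sym[of P Q] by linarith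
      ultimately show "Q \<in> G P \<union> bar ` G P" using Q barbar[OF QX(1)]
        by (auto simp: G_def intro!: image_eqI[of _ _ "bar Q"])
    qed
    then have "card (B P) \<le> card (G P \<union> bar ` G P)" using fG by (intro card_mono) auto
    also have "\<dots> \<le> card (G P) + card (bar ` G P)" by (rule card_Un_le)
    also have "\<dots> \<le> 2 * card (G P)" using card_image_le[OF fG, of bar P] by simp
    finally show ?thesis .
  qed
  then have "(\<Sum>P\<in>X. card X - 2) \<le> (\<Sum>P\<in>X. 2 * card (G P))" by (rule sum_mono)
  also have "\<dots> = 2 * card A" using fX fG by (simp add: A_def sum_distrib_left)
  finally have 1: "card X * (card X - 2) \<le> 2 * card A" by simp
  have "1 * card A \<le> 16 * card ({..<d} \<times> lines)"
  proof (rule card_le_fibres[where f = "\<lambda>p. (\<delta> (fst p) (snd p), line (fst p) (snd p))"])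
    show "finite A" using fX fG by (simp add: A_def)
    show "finite ({..<d} \<times> lines)" using finite_lines by simp
    show "(\<lambda>p. (\<delta> (fst p) (snd p), line (fst p) (snd p))) ` A \<subseteq> {..<d} \<times> lines"
      using dist_less inV by (auto simp: A_def G_def B_def intro!: line_in_lines)
  next
    fix b
    define S where "S = {p \<in> A. (\<delta> (fst p) (snd p), line (fst p) (snd p)) = b}"
    have "card S \<le> 16"
    proof (cases "S = {}")
      case False
      then obtain P Q where PQ: "(P, Q) \<in> S" by auto
      have "S \<subseteq> {P, bar P, Q, bar Q} \<times> {P, bar P, Q, bar Q}"
      proof
        fix p assume p: "p \<in> S"
        obtain P' Q' where p': "p = (P', Q')" by fastforce
        have m: "P \<in> X" "Q \<in> X" "P' \<in> X" "Q' \<in> X" "P \<noteq> Q" "Q \<noteq> bar P" "P' \<noteq> Q'" "Q' \<noteq> bar P'"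
          "\<delta> P Q = \<delta> P' Q'" "d \<le> 2 * \<delta> P' Q'" "line P Q = line P' Q'"
          using PQ p p' by (auto simp: S_def A_def G_def B_def)
        have "P' \<noteq> bar Q'" using m barbar by auto
        then have "P' \<in> {P, bar P, Q, bar Q}" "Q' \<in> {P, bar P, Q, bar Q}"
          using long_lines_differ[OF m(1-9) refl m(10,11)]
            long_lines_differ[OF m(1,2,4,3,5,6) m(7)[symmetric] _ m(9) sym m(10)]
            m(11) line_commute[of P' Q'] inV m by auto
        then show "p \<in> {P, bar P, Q, bar Q} \<times> {P, bar P, Q, bar Q}" unfolding p' by (rule SigmaI)
      qed
      then have "card S \<le> card ({P, bar P, Q, bar Q} \<times> {P, bar P, Q, bar Q})"
        by (intro card_mono) auto
      also have "\<dots> = card {P, bar P, Q, bar Q} * card {P, bar P, Q, bar Q}"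
        by (rule card_cartesian_product)
      also have "\<dots> \<le> 4 * 4" by (intro mult_le_mono card_quadruple_le)
      finally show ?thesis by simp
    qed simp
    then show "1 * card {p \<in> A. (\<delta> (fst p) (snd p), line (fst p) (snd p)) = b} \<le> 16"
      by (simp add: S_def)
  qed
  then have "card A \<le> 16 * (d * card lines)" by (simp add: card_cartesian_product)
  then show ?thesis using 1 by simp
qed

end

section \<open>Number of pairs generating one line\<close>

context geodesic_space
begin

text \<open>Fix one pair \<open>(x, y)\<close>. Without nesting, each pair of \<open>F\<close> has
  \<open>x\<close> or \<open>y\<close> behind or at one of its ends. Sorting by this observer, its
  distance to the nearer end and the orientation gives at most \<open>4 * (D + 1)\<close> classes,
  each bounded by \<open>bundle_card\<close>.\<close>

lemma same_line_card_no_inside: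
  assumes d: "2 \<le> d" and diam: "\<And>x y. x \<in> V \<Longrightarrow> y \<in> V \<Longrightarrow> \<delta> x y \<le> D"
    and F: "F = {(a, b). a \<in> V \<and> b \<in> V \<and> \<delta> a b = d \<and> line a b = L}"
    and no: "\<And>x y s t. \<lbrakk>(x, y) \<in> F; (s, t) \<in> F; \<delta> x s + \<delta> s y = d; s \<noteq> x; s \<noteq> y;
        \<delta> x t + \<delta> t y = d; t \<noteq> x; t \<noteq> y\<rbrakk> \<Longrightarrow> False"
  shows "card F ^ 2 \<le> 16 * (D + 1) ^ 2 * (4 * card lines + 1)"
proof (cases "F = {}")
  case False
  then obtain x y where xy: "(x, y) \<in> F" by auto
  have finF: "finite F" by (rule finite_subset[of _ "V \<times> V"]) (use F finV in auto)
  define G where "G i = {(z, w) \<in> F. \<delta> (fst i) z = snd i \<and> \<delta> (fst i) w = snd i + d}" for i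
  define I where "I = {x, y} \<times> {..D}"
  have finG: "finite (G i)" for i using finF by (rule finite_subset[rotated]) (auto simp: G_def)
  have finI: "finite I" "I \<noteq> {}" by (auto simp: I_def)
  define s where "s = Max ((\<lambda>i. card (G i)) ` I)"
  have Gs: "card (G i) \<le> s" if "i \<in> I" for i
    unfolding s_def using finI that by (intro Max_ge) auto
  have "s \<in> (\<lambda>i. card (G i)) ` I" unfolding s_def using finI by (intro Max_in) auto
  then obtain i where i: "i \<in> I" "s = card (G i)" by auto
  have s2: "s ^ 2 \<le> 4 * card lines + 1"
    unfolding i(2)
  proof (rule bundle_card[OF d, where o' = "fst i" and h = "snd i" and L = L])
    show "fst i \<in> V" using i F xy by (auto simp: I_def)
  qed (auto simp: G_def F)
  have "F \<subseteq> (\<Union>i\<in>I. G i \<union> prod.swap ` G i)"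
  proof
    fix p assume p: "p \<in> F"
    obtain z w where zw: "p = (z, w)" by fastforce
    have V: "z \<in> V" "w \<in> V" "x \<in> V" "y \<in> V" and dd: "\<delta> z w = d" and
      L: "line z w = L" "line x y = L" using p xy zw F by auto
    have ne: "z \<noteq> w" using d dd V refl0 by auto
    have sw: "(w, z) \<in> F" using p zw F sym[of w z] line_commute[of w z] by auto
    have one: "p \<in> (\<Union>i\<in>I. G i \<union> prod.swap ` G i)"
      if o': "o' \<in> {x, y}" and out: "\<not> (\<delta> z o' + \<delta> o' w = d \<and> o' \<noteq> z \<and> o' \<noteq> w)" for o'
    proof -
      have oV: "o' \<in> V" using o' V by auto
      have "o' \<in> line z w" using o' L ends_in_line V by auto
      then have "\<delta> o' w = \<delta> o' z + d \<or> \<delta> o' z = \<delta> o' w + d"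
        using mem_line[OF V(1,2) ne, of o'] out dd sym[of z w] sym[of z o'] sym[of w o'] refl0 V
        by auto
      then show ?thesis
      proof
        assume "\<delta> o' w = \<delta> o' z + d"
        then have "p \<in> G (o', \<delta> o' z)" using p zw by (simp add: G_def)
        moreover have "(o', \<delta> o' z) \<in> I" using o' diam[OF oV V(1)] by (simp add: I_def)
        ultimately show ?thesis by blast
      next
        assume "\<delta> o' z = \<delta> o' w + d"
        then have "(w, z) \<in> G (o', \<delta> o' w)" using sw by (simp add: G_def)
        then have "p \<in> prod.swap ` G (o', \<delta> o' w)" using zw by force
        moreover have "(o', \<delta> o' w) \<in> I" using o' diam[OF oV V(2)] by (simp add: I_def)
        ultimately show ?thesis by blast
      qed
    qed
    show "p \<in> (\<Union>i\<in>I. G i \<union> prod.swap ` G i)"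
      using no[of z w x y] p xy zw one[of x] one[of y] by auto
  qed
  then have "card F \<le> card (\<Union>i\<in>I. G i \<union> prod.swap ` G i)"
    using finI finG by (intro card_mono) auto
  also have "\<dots> \<le> (\<Sum>i\<in>I. card (G i \<union> prod.swap ` G i))" by (rule card_UN_le[OF finI(1)])
  also have "\<dots> \<le> (\<Sum>i\<in>I. 2 * s)"
  proof (rule sum_mono)
    fix i assume "i \<in> I"
    then have "card (G i) + card (prod.swap ` G i) \<le> 2 * s"
      using Gs card_image_le[OF finG, of prod.swap i] by fastforce
    then show "card (G i \<union> prod.swap ` G i) \<le> 2 * s" using card_Un_le le_trans by blast
  qed
  also have "\<dots> = card I * (2 * s)" by simp
  also have "\<dots> \<le> (2 * (D + 1)) * (2 * s)"
    using mult_le_mono1[OF card_pair_le[of x y], of "D + 1"]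
    by (intro mult_le_mono) (simp_all add: I_def card_cartesian_product)
  finally have "card F ^ 2 \<le> (4 * (D + 1) * s) ^ 2"
    by (intro power_mono) (auto simp: algebra_simps)
  also have "\<dots> = 16 * (D + 1) ^ 2 * s ^ 2" by (simp add: power2_eq_square algebra_simps)
  also have "\<dots> \<le> 16 * (D + 1) ^ 2 * (4 * card lines + 1)" using s2 by (intro mult_le_mono) auto
  finally show ?thesis .
qed simp

text \<open>If two pairs share the first end, the second end of one lies between the ends of the
  other and at full distance \<open>d\<close>, so the pairs coincide. Thus \<open>F\<close> is the
  graph of an involution and its ends form an antipodal family.\<close>

lemma same_line_card_between:
  assumes d: "0 < d"
    and F: "F = {(a, b). a \<in> V \<and> b \<in> V \<and> \<delta> a b = d \<and> line a b = L}"
    and btw: "\<And>p q v. (p, q) \<in> F \<Longrightarrow> v \<in> L \<Longrightarrow> \<delta> p v + \<delta> v q = d"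
  shows "card F * (card F - 2) \<le> 32 * d * card lines"
proof -
  define X where "X = fst ` F"
  have Fp: "a \<in> V" "b \<in> V" "\<delta> a b = d" "line a b = L" if "(a, b) \<in> F" for a b
    using that F by auto
  have FL: "a \<in> L" "b \<in> L" if "(a, b) \<in> F" for a b
    using Fp[OF that] ends_in_line by auto
  have uniq: "b = b'" if "(a, b) \<in> F" "(a, b') \<in> F" for a b b'
    using btw[OF that(1) FL(2)[OF that(2)]] Fp[OF that(1)] Fp[OF that(2)] zero[of b' b] by auto
  have swap: "(b, a) \<in> F" if "(a, b) \<in> F" for a b
    using Fp[OF that] F sym[of b a] line_commute by auto
  define bar where "bar a = (THE b. (a, b) \<in> F)" for a
  have bar: "bar a = b" if "(a, b) \<in> F" for a b
    unfolding bar_def using that uniq by blast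
  have barF: "(a, bar a) \<in> F" if "a \<in> X" for a
    using that bar by (force simp: X_def)
  interpret antipodal_family V \<delta> X bar d
  proof unfold_locales
    show "X \<subseteq> V" using Fp by (auto simp: X_def)
    show "bar P \<in> X" if "P \<in> X" for P using swap[OF barF[OF that]] by (force simp: X_def)
    show "bar (bar P) = P" if "P \<in> X" for P using bar[OF swap[OF barF[OF that]]] .
    show "\<delta> P (bar P) = d" if "P \<in> X" for P using Fp[OF barF[OF that]] by simp
    show "\<delta> P Q + \<delta> Q (bar P) = d" if "P \<in> X" "Q \<in> X" for P Q
      using btw[OF barF[OF that(1)] FL(1)[OF barF[OF that(2)]]] .
  qed (rule d)
  have "inj_on fst F" using uniq by (auto simp: inj_on_def)
  then have "card X = card F" by (simp add: X_def card_image)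
  then show ?thesis using antipodal_card by simp
qed

lemma same_line_card:
  assumes d: "2 \<le> d" and diam: "\<And>x y. x \<in> V \<Longrightarrow> y \<in> V \<Longrightarrow> \<delta> x y \<le> D"
    and F: "F = {(a, b). a \<in> V \<and> b \<in> V \<and> \<delta> a b = d \<and> line a b = L}"
  shows "card F ^ 2 \<le> 16 * (D + 1) ^ 2 * (4 * card lines + 1)"
proof (cases "\<exists>x y s t. (x, y) \<in> F \<and> (s, t) \<in> F \<and> \<delta> x s + \<delta> s y = d \<and> s \<noteq> x \<and> s \<noteq> y \<and>
        \<delta> x t + \<delta> t y = d \<and> t \<noteq> x \<and> t \<noteq> y")
  case False
  show ?thesis by (rule same_line_card_no_inside[OF d diam F]) (use False in metis)+
next
  case True
  then obtain x y s t where *: "(x, y) \<in> F" "(s, t) \<in> F" "\<delta> x s + \<delta> s y = d" "s \<noteq> x" "s \<noteq> y"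
        "\<delta> x t + \<delta> t y = d" "t \<noteq> x" "t \<noteq> y" by blast
  have "card F * (card F - 2) \<le> 32 * d * card lines"
    by (rule same_line_card_between[OF _ F one_inside_all_between[OF F *]]) (use d in auto)
  also have "\<dots> \<le> 32 * (D + 1) ^ 2 * card lines"
  proof (intro mult_le_mono le_refl)
    have "d \<le> D" using diam * F by fastforce
    then show "d \<le> (D + 1) ^ 2" by (simp add: power2_eq_square)
  qed
  finally have 1: "card F * (card F - 2) \<le> 32 * (D + 1) ^ 2 * card lines" .
  \<comment> \<open>From four pairs on, \<open>card F \<le> 2 * (card F - 2)\<close>; below that the
    product may vanish and a constant bound serves.\<close>
  show ?thesis
  proof (cases "card F \<le> 3")
    case True
    then have "card F ^ 2 \<le> 3 ^ 2" by (intro power_mono) auto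
    also have "\<dots> \<le> 16 * (1 * 1)" by simp
    also have "\<dots> \<le> 16 * ((D + 1) ^ 2 * (4 * card lines + 1))"
      by (intro mult_le_mono) auto
    finally show ?thesis by (simp add: mult.assoc)
  next
    case False
    then have "card F * card F \<le> card F * (2 * (card F - 2))" by (intro mult_le_mono) auto
    also have "\<dots> \<le> 64 * (D + 1) ^ 2 * card lines" using 1 by simp
    also have "\<dots> \<le> 16 * (D + 1) ^ 2 * (4 * card lines + 1)" by (simp add: algebra_simps)
    finally show ?thesis by (simp add: power2_eq_square)
  qed
qed

lemma far_pairs_card:
  assumes d: "2 \<le> d" and diam: "\<And>x y. x \<in> V \<Longrightarrow> y \<in> V \<Longrightarrow> \<delta> x y \<le> D"
    and P: "P = {(a, b). a \<in> V \<and> b \<in> V \<and> \<delta> a b = d}"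
  shows "card P ^ 2 \<le> 16 * (D + 1) ^ 2 * (4 * card lines + 1) * card lines ^ 2"
proof (cases "P = {}")
  case False
  have finP: "finite P" by (rule finite_subset[of _ "V \<times> V"]) (use P finV in auto)
  define f where "f p = line (fst p) (snd p)" for p
  define s where "s = Max ((\<lambda>L. card {p \<in> P. f p = L}) ` lines)"
  have fP: "f ` P \<subseteq> lines" using P d refl0 by (force simp: f_def intro: line_in_lines)
  then have ne: "lines \<noteq> {}" using False by auto
  have "s \<in> (\<lambda>L. card {p \<in> P. f p = L}) ` lines"
    unfolding s_def using finite_lines ne by (intro Max_in) auto
  then obtain L where L: "s = card {p \<in> P. f p = L}" by auto
  have PL: "{p \<in> P. f p = L} = {(a, b). a \<in> V \<and> b \<in> V \<and> \<delta> a b = d \<and> line a b = L}"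
    using P by (auto simp: f_def)
  have s2: "s ^ 2 \<le> 16 * (D + 1) ^ 2 * (4 * card lines + 1)"
    unfolding L by (rule same_line_card[OF d diam PL])
  have "1 * card P \<le> s * card lines"
  proof (rule card_le_fibres[OF finP finite_lines fP])
    show "1 * card {p \<in> P. f p = L} \<le> s" if "L \<in> lines" for L
      unfolding s_def using finite_lines that by (auto intro!: Max_ge)
  qed
  then have "card P ^ 2 \<le> (s * card lines) ^ 2" by (intro power_mono) auto
  also have "\<dots> = s ^ 2 * card lines ^ 2" by (simp add: power_mult_distrib)
  also have "\<dots> \<le> 16 * (D + 1) ^ 2 * (4 * card lines + 1) * card lines ^ 2"
    using s2 by (rule mult_le_mono1)
  finally show ?thesis .
qed simp

end

text \<open>Cauchy-Schwarz for the fibre sizes: the sum on the right is the sum of their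
  squares.\<close>

lemma card_squared_le_fibres:
  assumes "finite A"
  shows "card A ^ 2 \<le> card (f ` A) * (\<Sum>a\<in>A. card {b \<in> A. f b = f a})"
proof -
  define s where "s y = card {b \<in> A. f b = y}" for y
  have "card A = (\<Sum>a\<in>A. 1)" by simp
  also have "\<dots> = (\<Sum>y\<in>f ` A. \<Sum>a\<in>{b \<in> A. f b = y}. 1)"
    by (rule sum.image_gen[OF assms])
  finally have 1: "card A = (\<Sum>y\<in>f ` A. s y)" by (simp add: s_def)
  have "(\<Sum>a\<in>A. card {b \<in> A. f b = f a}) = (\<Sum>y\<in>f ` A. \<Sum>a\<in>{b \<in> A. f b = y}. s (f a))"
    unfolding s_def by (rule sum.image_gen[OF assms])
  also have "\<dots> = (\<Sum>y\<in>f ` A. s y ^ 2)"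
    by (intro sum.cong) (auto simp: s_def power2_eq_square)
  finally have 2: "(\<Sum>a\<in>A. card {b \<in> A. f b = f a}) = (\<Sum>y\<in>f ` A. s y ^ 2)" .
  have "(\<Sum>y\<in>f ` A. real (s y))\<^sup>2 \<le> (\<Sum>y\<in>f ` A. (real (s y))\<^sup>2) * real (card (f ` A))"
    by (rule sum_squared_le_sum_of_squares)
  then have "real ((\<Sum>y\<in>f ` A. s y)\<^sup>2) \<le> real ((\<Sum>y\<in>f ` A. s y ^ 2) * card (f ` A))" by simp
  then have "(\<Sum>y\<in>f ` A. s y)\<^sup>2 \<le> (\<Sum>y\<in>f ` A. s y ^ 2) * card (f ` A)"
    unfolding of_nat_le_iff .
  then show ?thesis using 1 2 by (simp add: mult.commute)
qed

section \<open>Subsets of diameter two\<close>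

text \<open>Distances are those of \<open>V\<close>; a geodesic between points of \<open>U\<close>
  may leave \<open>U\<close>.\<close>

locale diameter_two_part = geodesic_space +
  fixes U :: "'a set"
  assumes UV: "U \<subseteq> V"
    and two: "a \<in> U \<Longrightarrow> b \<in> U \<Longrightarrow> \<delta> a b \<le> 2"
begin

text \<open>A point of \<open>U\<close> belongs to its own set, so twins, that is points of
  \<open>U\<close> with equal sets, are non-adjacent to each other.\<close>

definition nonadj :: "'a \<Rightarrow> 'a set" where
  "nonadj a = {u \<in> U. \<delta> a u \<noteq> 1}"

lemma finU: "finite U"
  using finV UV finite_subset by blast

lemma finite_nonadj: "finite (nonadj a)"
  using finU by (simp add: nonadj_def)

lemma inV: "a \<in> U \<Longrightarrow> a \<in> V"
  using UV by auto

lemma self_nonadj: "a \<in> U \<Longrightarrow> a \<in> nonadj a"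
  using refl0 inV by (auto simp: nonadj_def)

lemma nonadj_sym: "a \<in> U \<Longrightarrow> b \<in> U \<Longrightarrow> b \<in> nonadj a \<longleftrightarrow> a \<in> nonadj b"
  using sym[of a b] by (simp add: nonadj_def)

lemma dist_cases:
  assumes "a \<in> U" "b \<in> U"
  shows "\<delta> a b = (if a = b then 0 else if b \<in> nonadj a then 2 else 1)"
  using two[OF assms] zero[OF assms[THEN inV]] assms by (auto simp: nonadj_def)

text \<open>For adjacent \<open>a\<close>, \<open>b\<close> and distances at most 2, a point of
  \<open>U\<close> is on the line exactly when its distances to \<open>a\<close> and
  \<open>b\<close> differ, that is when exactly one of them is 1. With closed non-neighbourhoods,
  \<open>a\<close> and \<open>b\<close> follow the same rule.\<close>

lemma adjacent_line:
  assumes U: "a \<in> U" "b \<in> U" and b: "b \<notin> nonadj a"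
  shows "line a b \<inter> U = sym_diff (nonadj a) (nonadj b)"
proof -
  have ne: "a \<noteq> b" "a \<notin> nonadj b" and ab: "\<delta> a b = 1"
    using b self_nonadj[OF U(1)] nonadj_sym[OF U] dist_cases[OF U] by auto
  have "c \<in> line a b \<longleftrightarrow> (c \<in> nonadj a) \<noteq> (c \<in> nonadj b)" if c: "c \<in> U" for c
  proof (cases "c = a \<or> c = b")
    case True
    then show ?thesis using b ne self_nonadj[OF U(1)] self_nonadj[OF U(2)] ends_in_line[OF inV[OF U(1)] inV[OF U(2)]]
      by auto
  next
    case False
    have "c \<in> line a b \<longleftrightarrow> (\<delta> a b = \<delta> a c + \<delta> b c \<or> \<delta> a c = \<delta> a b + \<delta> b c \<or> \<delta> b c = \<delta> a c + \<delta> a b)"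
      using mem_line[OF inV[OF U(1)] inV[OF U(2)] ne(1), of c] sym[of c a] sym[of c b] inV[OF c] by simp
    then show ?thesis using False ab dist_cases[OF U(1) c] dist_cases[OF U(2) c]
      by (auto split: if_splits)
  qed
  moreover have "nonadj a \<subseteq> U" "nonadj b \<subseteq> U" by (auto simp: nonadj_def)
  ultimately show ?thesis by blast
qed

text \<open>Distances at most 2 leave no room beyond the ends, so besides \<open>a\<close> and
  \<open>b\<close> only common neighbours remain.\<close>

lemma distance_two_line:
  assumes U: "a \<in> U" "b \<in> U" "c \<in> U" and b: "\<delta> a b = 2"
  shows "c \<in> line a b \<longleftrightarrow> c = a \<or> c = b \<or> c \<notin> nonadj a \<union> nonadj b"
proof -
  have ne: "a \<noteq> b" using b refl0[OF inV[OF U(1)]] by auto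
  have "c \<in> line a b \<longleftrightarrow> (\<delta> a b = \<delta> a c + \<delta> b c \<or> \<delta> a c = \<delta> a b + \<delta> b c \<or> \<delta> b c = \<delta> a c + \<delta> a b)"
    using mem_line[OF inV[OF U(1)] inV[OF U(2)] ne, of c] sym[of c a] sym[of c b] inV[OF U(3)] by simp
  then show ?thesis
    using b ne dist_cases[OF U(1,3)] dist_cases[OF U(2,3)] sym[of b a] by (auto split: if_splits)
qed

lemma distance_two_lines_share:
  assumes "a \<in> U" "b \<in> U" "c \<in> U" "\<delta> a b = 2" "\<delta> a c = 2" "line a b = line a c"
  shows "b = c"
proof -
  have "c \<in> line a b" using assms ends_in_line inV by metis
  moreover have "c \<in> nonadj a" "c \<noteq> a" using assms refl0 inV by (auto simp: nonadj_def)
  ultimately show ?thesis using distance_two_line[OF assms(1-4)] by auto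
qed

text \<open>A twin \<open>t\<close> of \<open>a\<close> is off the line, so it lies in \<open>nonadj c \<union> nonadj d\<close>; whichever of \<open>c\<close>, \<open>d\<close> it
  is non-adjacent to is then non-adjacent to \<open>a\<close> while on the line, hence \<open>a\<close> or \<open>b\<close>.\<close>

lemma twin_pair_line_unique:
  assumes U: "a \<in> U" "b \<in> U" "c \<in> U" "d \<in> U"
    and dd: "\<delta> a b = 2" "\<delta> c d = 2" and L: "line a b = line c d"
    and t: "t \<in> U" "nonadj t = nonadj a" "t \<noteq> a" "t \<noteq> b"
  shows "c \<in> {a, b} \<and> d \<in> {a, b}"
proof -
  have "t \<in> nonadj a" using t self_nonadj by blast
  then have "t \<notin> line c d" using distance_two_line[OF U(1,2) t(1) dd(1)] t L by auto
  then have "t \<in> nonadj c \<or> t \<in> nonadj d" using distance_two_line[OF U(3,4) t(1) dd(2)] by auto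
  then have "c \<in> nonadj a \<or> d \<in> nonadj a" using nonadj_sym t U by auto
  moreover have "c \<in> line a b" "d \<in> line a b" using L ends_in_line U inV by auto
  ultimately have "c \<in> {a, b} \<or> d \<in> {a, b}"
    using distance_two_line[OF U(1,2,3) dd(1)] distance_two_line[OF U(1,2,4) dd(1)] by auto
  moreover have "line b a = line a b" "line d c = line c d" "\<delta> b a = 2" "\<delta> d c = 2"
    using line_commute[of b a] line_commute[of d c] U inV dd sym[of b a] sym[of d c] by auto
  ultimately show ?thesis
    using distance_two_lines_share[OF U(1,2,4)] distance_two_lines_share[OF U(2,1,4)]
      distance_two_lines_share[OF U(1,2,3)] distance_two_lines_share[OF U(2,1,3)] dd L
    by (elim disjE insertE emptyE) simp_all
qed

end

section \<open>Points with many twins, and lines of adjacent pairs\<close>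

context diameter_two_part
begin

text \<open>A class of size at least three contains a twin of \<open>a\<close> other than
  \<open>b\<close>, so by \<open>twin_pair_line_unique\<close> each line comes from at most two
  ordered pairs at distance 2 starting in \<open>T\<close>.\<close>

lemma twin_pairs_card:
  assumes T: "T \<subseteq> U" "\<And>a. a \<in> T \<Longrightarrow> 3 \<le> card {b \<in> U. nonadj b = nonadj a}"
  shows "(\<Sum>a\<in>T. card (nonadj a)) \<le> 3 * card lines"
proof -
  have finT: "finite T" using T finU finite_subset by blast
  define A where "A = Sigma T (\<lambda>a. nonadj a - {a})"
  have A: "a \<in> U" "b \<in> U" "\<delta> a b = 2" "a \<noteq> b" "a \<in> T" if "(a, b) \<in> A" for a b
    using that T dist_cases[of a b] by (auto simp: A_def nonadj_def split: if_splits)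
  have 1: "1 * card A \<le> 2 * card lines"
  proof (rule card_le_fibres[where f = "\<lambda>p. line (fst p) (snd p)"])
    show "finite A" using finT finite_nonadj by (simp add: A_def)
    show "finite lines" by (rule finite_lines)
    show "(\<lambda>p. line (fst p) (snd p)) ` A \<subseteq> lines"
      using A inV by (force intro: line_in_lines)
  next
    fix L
    define S where "S = {p \<in> A. line (fst p) (snd p) = L}"
    have "card S \<le> 2"
    proof (cases "S = {}")
      case False
      then obtain a b where ab: "(a, b) \<in> S" by auto
      then have abA: "(a, b) \<in> A" by (simp add: S_def)
      have "\<not> {t \<in> U. nonadj t = nonadj a} \<subseteq> {a, b}"
      proof
        assume "{t \<in> U. nonadj t = nonadj a} \<subseteq> {a, b}"
        then have "card {t \<in> U. nonadj t = nonadj a} \<le> card {a, b}" by (intro card_mono) auto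
        then show False using card_pair_le[of a b] T(2)[OF A(5)[OF abA]] by linarith
      qed
      then obtain t where t: "t \<in> U" "nonadj t = nonadj a" "t \<noteq> a" "t \<noteq> b" by auto
      have "S \<subseteq> {(a, b), (b, a)}"
      proof
        fix p assume p: "p \<in> S"
        obtain c d where cd: "p = (c, d)" by fastforce
        have cdA: "(c, d) \<in> A" using p cd by (simp add: S_def)
        have "line a b = line c d" using ab p cd by (simp add: S_def)
        then have "c \<in> {a, b} \<and> d \<in> {a, b}"
          by (rule twin_pair_line_unique[OF A(1,2)[OF abA] A(1,2)[OF cdA] A(3)[OF abA] A(3)[OF cdA] _ t])
        then show "p \<in> {(a, b), (b, a)}" using cd A(4)[OF cdA] by auto
      qed
      then have "card S \<le> card {(a, b), (b, a)}" by (intro card_mono) auto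
      also have "\<dots> \<le> 2" by (rule card_pair_le)
      finally show ?thesis .
    qed simp
    then show "1 * card {p \<in> A. line (fst p) (snd p) = L} \<le> 2" by (simp add: S_def)
  qed
  \<comment> \<open>\<open>nonadj a\<close> contains the whole twin class of \<open>a\<close>, so
    its size \<open>k\<close> is at least 3 and \<open>2 * k \<le> 3 * (k - 1)\<close>; this
    restores the point \<open>a\<close> left out of the pairs.\<close>
  have "2 * (\<Sum>a\<in>T. card (nonadj a)) = (\<Sum>a\<in>T. 2 * card (nonadj a))"
    by (rule sum_distrib_left)
  also have "\<dots> \<le> (\<Sum>a\<in>T. 3 * card (nonadj a - {a}))"
  proof (rule sum_mono)
    fix a assume a: "a \<in> T"
    have "3 \<le> card {b \<in> U. nonadj b = nonadj a}" by (rule T(2)[OF a])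
    also have "\<dots> \<le> card (nonadj a)"
      using self_nonadj by (intro card_mono[OF finite_nonadj]) auto
    finally have "3 \<le> card (nonadj a)" .
    moreover have "card (nonadj a - {a}) = card (nonadj a) - 1"
      using a T self_nonadj by (auto intro: card_Diff_singleton)
    ultimately show "2 * card (nonadj a) \<le> 3 * card (nonadj a - {a})" by linarith
  qed
  also have "\<dots> = 3 * card A"
    using finT finite_nonadj by (simp add: A_def sum_distrib_left)
  finally show ?thesis using 1 by linarith
qed

text \<open>Given the trace \<open>S\<close> of the line on \<open>U\<close>, the second generator \<open>b\<close> determines
  \<open>nonadj a = sym_diff S (nonadj b)\<close>, hence the representative \<open>a\<close>; and \<open>b \<in> S\<close>.\<close>

lemma adjacent_pairs_card:
  assumes R: "R \<subseteq> U" "inj_on nonadj R" and W: "W \<subseteq> U"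
    and small: "\<And>a. a \<in> R \<union> W \<Longrightarrow> n * card (nonadj a) \<le> M"
  shows "n * card (Sigma R (\<lambda>a. W - nonadj a)) \<le> 2 * M * card lines"
proof -
  define A where "A = Sigma R (\<lambda>a. W - nonadj a)"
  have fin: "finite R" "finite W" using R W finU finite_subset by blast+
  have A: "a \<in> R" "b \<in> W" "a \<in> U" "b \<in> U" "b \<notin> nonadj a" "a \<noteq> b" if "(a, b) \<in> A" for a b
    using that R W self_nonadj by (auto simp: A_def)
  have "n * card A \<le> 2 * M * card lines"
  proof (rule card_le_fibres[where f = "\<lambda>p. line (fst p) (snd p)"])
    show "finite A" using fin by (simp add: A_def)
    show "finite lines" by (rule finite_lines)
    show "(\<lambda>p. line (fst p) (snd p)) ` A \<subseteq> lines"
      using A inV by (force intro: line_in_lines)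
  next
    fix L
    define F where "F = {p \<in> A. line (fst p) (snd p) = L}"
    have FL: "L \<inter> U = sym_diff (nonadj a) (nonadj b)" if "(a, b) \<in> F" for a b
    proof -
      have *: "(a, b) \<in> A" "line a b = L" using that by (auto simp: F_def)
      show ?thesis using adjacent_line[OF A(3-5)[OF *(1)]] *(2) by simp
    qed
    have "n * card F \<le> 2 * M"
    proof (cases "F = {}")
      case False
      then obtain a b where ab: "(a, b) \<in> F" by auto
      then have abA: "(a, b) \<in> A" by (simp add: F_def)
      have inj: "inj_on snd F"
      proof (rule inj_onI)
        fix p q assume pq: "p \<in> F" "q \<in> F" "snd p = snd q"
        obtain c d c' where cd: "p = (c, d)" "q = (c', d)" using pq(3) by (metis prod.collapse)
        have "sym_diff (nonadj c) (nonadj d) = sym_diff (nonadj c') (nonadj d)"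
          using FL[of c d] FL[of c' d] pq cd by simp
        then have "nonadj c = nonadj c'" by blast
        moreover have "c \<in> R" "c' \<in> R" using A(1) pq cd by (auto simp: F_def)
        ultimately show "p = q" using R(2) cd by (simp add: inj_on_def)
      qed
      have "snd ` F \<subseteq> nonadj a \<union> nonadj b"
      proof
        fix d assume "d \<in> snd ` F"
        then obtain c where cd: "(c, d) \<in> F" by auto
        then have *: "(c, d) \<in> A" by (simp add: F_def)
        have "d \<in> L \<inter> U" using FL[OF cd] A(4,5)[OF *] self_nonadj by auto
        then show "d \<in> nonadj a \<union> nonadj b" using FL[OF ab] by blast
      qed
      then have "card (snd ` F) \<le> card (nonadj a \<union> nonadj b)"
        using finite_nonadj by (intro card_mono) auto
      also have "\<dots> \<le> card (nonadj a) + card (nonadj b)" by (rule card_Un_le)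
      finally have "n * card F \<le> n * (card (nonadj a) + card (nonadj b))"
        using card_image[OF inj] by (intro mult_le_mono) auto
      also have "\<dots> \<le> M + M"
        unfolding distrib_left using small A(1,2)[OF abA] by (intro add_mono) auto
      finally show ?thesis by simp
    qed simp
    then show "n * card {p \<in> A. line (fst p) (snd p) = L} \<le> 2 * M" by (simp add: F_def)
  qed
  then show ?thesis by (simp add: A_def)
qed

text \<open>Each \<open>nonadj a\<close> has at most \<open>n / 32 + 1\<close>, hence at most
  \<open>n / 16\<close>, points, while \<open>W\<close> has at least \<open>n / 8\<close>.\<close>

lemma many_adjacent_pairs:
  assumes R: "R \<subseteq> U" and n: "32 \<le> n" "n \<le> 8 * card W"
    and small: "\<And>a. a \<in> U \<Longrightarrow> 32 * card (nonadj a) \<le> n + 32"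
  shows "card R * n \<le> 16 * card (Sigma R (\<lambda>a. W - nonadj a))"
proof -
  have fin: "finite R" "finite W"
    using R finU finite_subset n card.infinite[of W] by (blast, fastforce)
  have "card R * n = (\<Sum>a\<in>R. n)" by simp
  also have "\<dots> \<le> (\<Sum>a\<in>R. 16 * card (W - nonadj a))"
  proof (rule sum_mono)
    fix a assume "a \<in> R"
    then have "32 * card (nonadj a) \<le> n + 32" using small R by auto
    moreover have "card W - card (nonadj a) \<le> card (W - nonadj a)"
      by (rule diff_card_le_card_Diff[OF finite_nonadj])
    ultimately show "n \<le> 16 * card (W - nonadj a)" using n by linarith
  qed
  also have "\<dots> = 16 * card (Sigma R (\<lambda>a. W - nonadj a))"
    using fin by (simp add: sum_distrib_left)
  finally show ?thesis .
qed

text \<open>With \<open>m\<close> lines, \<open>R\<close> a set of class representatives in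
  \<open>W\<close>, two bounds are multiplied: \<open>n ^ 2 \<le> 192 * (card R * m)\<close>, as
  small non-neighbourhoods force many classes, and \<open>card R * n ^ 2 \<le> 768 * m ^ 2\<close>,
  from the adjacent pairs between \<open>R\<close> and \<open>W\<close>.\<close>

lemma many_twins_bound:
  assumes T: "T = {a \<in> U. 3 \<le> card {b \<in> U. nonadj b = nonadj a}}"
    and n: "32 \<le> n" "n \<le> 4 * card T"
    and small: "\<And>a. a \<in> U \<Longrightarrow> 32 * card (nonadj a) \<le> n + 32"
  shows "n ^ 4 \<le> 147456 * card lines ^ 3"
proof -
  define m where "m = card lines"
  have TU: "T \<subseteq> U" and finT: "finite T" using T finU by auto
  have s: "(\<Sum>a\<in>T. card (nonadj a)) \<le> 3 * m"
    unfolding m_def using T by (intro twin_pairs_card) auto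
  \<comment> \<open>Markov's inequality: the threshold is eight times the average
    \<open>3 * m / n\<close>, so at most \<open>n / 8\<close> points of \<open>T\<close> are
    lost.\<close>
  define W where "W = {a \<in> T. n * card (nonadj a) \<le> 24 * m}"
  have finW: "finite W" and WU: "W \<subseteq> U" using finT TU by (auto simp: W_def)
  obtain a where a: "a \<in> T" using n by fastforce
  have "card (nonadj a) \<le> (\<Sum>a\<in>T. card (nonadj a))" using finT a by (intro member_le_sum) auto
  moreover have "card (nonadj a) > 0"
    using self_nonadj[of a] a TU finite_nonadj by (auto simp: card_gt_0_iff)
  ultimately have m0: "m > 0" using s by linarith
  have "card (T - W) * (24 * m) = (\<Sum>a\<in>T - W. 24 * m)" by simp
  also have "\<dots> \<le> (\<Sum>a\<in>T - W. n * card (nonadj a))"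
    by (intro sum_mono) (auto simp: W_def)
  also have "\<dots> \<le> (\<Sum>a\<in>T. n * card (nonadj a))" using finT by (intro sum_mono2) auto
  also have "\<dots> = n * (\<Sum>a\<in>T. card (nonadj a))" by (simp add: sum_distrib_left)
  also have "\<dots> \<le> n * (3 * m)" using s by (rule mult_le_mono2)
  finally have "(8 * card (T - W)) * (3 * m) \<le> n * (3 * m)" by simp
  then have "8 * card (T - W) \<le> n" using m0 by simp
  moreover have "card T = card W + card (T - W)"
    using finT by (subst card_Un_disjoint[symmetric]) (auto simp: W_def intro: arg_cong[of _ _ card])
  ultimately have W8: "n \<le> 8 * card W" using n by linarith
  obtain R where R: "R \<subseteq> W" "inj_on nonadj R" "nonadj ` W = nonadj ` R"
    using subset_image_inj[of "nonadj ` W" nonadj W] by auto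
  have cR: "card (nonadj ` W) = card R" using R card_image by metis
  \<comment> \<open>Cauchy-Schwarz over the twin classes; the class of \<open>a\<close> is contained
    in \<open>nonadj a\<close>.\<close>
  have "card W ^ 2 \<le> card R * (\<Sum>a\<in>W. card {b \<in> W. nonadj b = nonadj a})"
    using card_squared_le_fibres[OF finW, of nonadj] cR by simp
  also have "\<dots> \<le> card R * (\<Sum>a\<in>W. card (nonadj a))"
    using self_nonadj WU finite_nonadj by (intro mult_le_mono2 sum_mono card_mono) auto
  also have "\<dots> \<le> card R * (\<Sum>a\<in>T. card (nonadj a))"
    using finT by (intro mult_le_mono2 sum_mono2) (auto simp: W_def)
  also have "\<dots> \<le> card R * (3 * m)" using s by (rule mult_le_mono2)
  finally have W2: "card W ^ 2 \<le> 3 * (card R * m)" by simp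
  have "n * card (Sigma R (\<lambda>a. W - nonadj a)) \<le> 2 * (24 * m) * m"
    unfolding m_def
    by (rule adjacent_pairs_card[OF _ R(2) WU]) (use R(1) WU in \<open>auto simp: W_def m_def\<close>)
  moreover have "card R * n \<le> 16 * card (Sigma R (\<lambda>a. W - nonadj a))"
    using R WU by (intro many_adjacent_pairs[OF _ n(1) W8 small]) auto
  then have "n * (card R * n) \<le> n * (16 * card (Sigma R (\<lambda>a. W - nonadj a)))" by (rule mult_le_mono2)
  ultimately have "n * (card R * n) \<le> 16 * (2 * (24 * m) * m)" by linarith
  then have r: "card R * n ^ 2 \<le> 768 * m ^ 2" by (simp add: power2_eq_square mult_ac)
  have "n ^ 2 \<le> (8 * card W) ^ 2" using W8 by (intro power_mono) auto
  then have "n ^ 2 \<le> 192 * (card R * m)" using W2 by (simp add: power_mult_distrib)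
  then have "n ^ 2 * n ^ 2 \<le> 192 * (card R * m) * n ^ 2" by (rule mult_le_mono1)
  also have "\<dots> = 192 * m * (card R * n ^ 2)" by (simp add: mult_ac)
  also have "\<dots> \<le> 192 * m * (768 * m ^ 2)" using r by (rule mult_le_mono2)
  finally show ?thesis
    unfolding m_def by (simp add: power2_eq_square power3_eq_cube power4_eq_xxxx mult_ac)
qed

end

section \<open>Matchings of adjacent pairs, and points with few twins\<close>

text \<open>\<open>X\<close> models the ends of the adjacent pairs of representatives generating one
  line, with \<open>bar\<close> the partner in the matching. Each end lies in the symmetric
  difference of \<open>nonadj P\<close> and \<open>nonadj (bar P)\<close>, which is
  \<open>split\<close>.\<close>

locale complementary_family = diameter_two_part +
  fixes X :: "'a set" and bar :: "'a \<Rightarrow> 'a"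
  assumes XU: "X \<subseteq> U"
    and barX: "P \<in> X \<Longrightarrow> bar P \<in> X"
    and barbar: "P \<in> X \<Longrightarrow> bar (bar P) = P"
    and split: "P \<in> X \<Longrightarrow> Q \<in> X \<Longrightarrow> Q \<in> nonadj P \<longleftrightarrow> Q \<notin> nonadj (bar P)"
begin

lemma split': "P \<in> X \<Longrightarrow> Q \<in> X \<Longrightarrow> bar Q \<in> nonadj P \<longleftrightarrow> Q \<notin> nonadj P"
  using split[of Q P] nonadj_sym[of P Q] nonadj_sym[of P "bar Q"] XU barX by blast

text \<open>A point \<open>R\<close> of the line other than \<open>P\<close>, \<open>Q\<close> is adjacent to \<open>P\<close>, so \<open>bar R\<close> is not and is off
  the line of \<open>P\<close> and \<open>Q\<close>; but \<open>bar R\<close> is adjacent to both \<open>R\<close> and \<open>S\<close>.\<close>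

lemma distance_two_lines_differ:
  assumes X: "P \<in> X" "Q \<in> X" "R \<in> X" "S \<in> X"
    and dd: "\<delta> P Q = 2" "\<delta> R S = 2" and L: "line P Q = line R S"
  shows "R \<in> {P, bar P, Q, bar Q}"
proof -
  have U: "P \<in> U" "Q \<in> U" "R \<in> U" "S \<in> U" "bar R \<in> U" using X XU barX by auto
  have R: "R \<in> line P Q" using L ends_in_line inV U by auto
  have "R \<in> nonadj R" "R \<in> nonadj S"
    using self_nonadj U dd(2) sym[of R S] by (auto simp: nonadj_def)
  then have "bar R \<in> line R S"
    using distance_two_line[OF U(3-5) dd(2)] split'[OF X(3,3)] split'[OF X(4,3)] by auto
  then have "bar R = P \<or> bar R = Q \<or> bar R \<notin> nonadj P \<union> nonadj Q"
    using distance_two_line[OF U(1,2,5) dd(1)] L by auto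
  moreover have "R = P \<or> R = Q \<or> R \<notin> nonadj P \<union> nonadj Q"
    using distance_two_line[OF U(1-3) dd(1)] R by auto
  ultimately show ?thesis using split'[OF X(1,3)] barbar[OF X(3)] by auto
qed

text \<open>Exactly one of \<open>Q\<close>, \<open>bar Q\<close> is non-adjacent to
  \<open>P\<close>, so about half of all ordered pairs are at distance 2, and each line comes from
  at most \<open>4 * 4\<close> of them.\<close>

lemma complementary_card: "card X ^ 2 \<le> 64 * card lines"
proof (cases "card X \<le> 3")
  case True
  \<comment> \<open>A nonempty \<open>X\<close> has two points, because \<open>split\<close> rules
    out \<open>bar P = P\<close>; hence there is at least one line.\<close>
  show ?thesis
  proof (cases "\<exists>P Q. P \<in> X \<and> Q \<in> X \<and> P \<noteq> Q")
    case True
    then obtain P Q where "P \<in> V" "Q \<in> V" "P \<noteq> Q" using XU inV by blast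
    then have "lines \<noteq> {}" using line_in_lines[of P Q] by auto
    then have "card lines > 0" using finite_lines by (simp add: card_gt_0_iff)
    moreover have "card X ^ 2 \<le> 3 ^ 2" using \<open>card X \<le> 3\<close> by (intro power_mono) auto
    ultimately show ?thesis by simp
  next
    case False
    have "X = {}"
    proof (rule ccontr)
      assume "X \<noteq> {}"
      then obtain P where P: "P \<in> X" by auto
      then have "bar P = P" using barX False by blast
      then show False using split[OF P P] by simp
    qed
    then show ?thesis by simp
  qed
next
  case False
  have fX: "finite X" using XU finU finite_subset by blast
  define G where "G P = X \<inter> nonadj P - {P}" for P
  define A where "A = Sigma X G"
  have fG: "finite (G P)" for P using fX by (simp add: G_def)
  have A: "P \<in> X" "Q \<in> X" "P \<in> U" "Q \<in> U" "\<delta> P Q = 2" "P \<noteq> Q" if "(P, Q) \<in> A" for P Q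
    using that XU dist_cases[of P Q] by (auto simp: A_def G_def subset_iff)
  have "card X \<le> 2 * card (G P) + 2" if P: "P \<in> X" for P
  proof -
    have "X \<subseteq> (X \<inter> nonadj P) \<union> bar ` (X \<inter> nonadj P)"
    proof
      fix Q assume Q: "Q \<in> X"
      show "Q \<in> (X \<inter> nonadj P) \<union> bar ` (X \<inter> nonadj P)"
        using split'[OF P Q] Q barX[OF Q] barbar[OF Q]
        by (cases "Q \<in> nonadj P") (auto intro!: image_eqI[of _ _ "bar Q"])
    qed
    then have "card X \<le> card ((X \<inter> nonadj P) \<union> bar ` (X \<inter> nonadj P))"
      using fX by (intro card_mono) auto
    also have "\<dots> \<le> card (X \<inter> nonadj P) + card (bar ` (X \<inter> nonadj P))" by (rule card_Un_le)
    also have "\<dots> \<le> 2 * card (X \<inter> nonadj P)"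
      using card_image_le[of "X \<inter> nonadj P" bar] fX by simp
    also have "card (X \<inter> nonadj P) = Suc (card (G P))"
      unfolding G_def using P XU self_nonadj fX by (intro card.remove) auto
    finally show ?thesis by simp
  qed
  then have "(\<Sum>P\<in>X. card X) \<le> (\<Sum>P\<in>X. 2 * card (G P) + 2)" by (rule sum_mono)
  also have "\<dots> = 2 * card A + 2 * card X"
    unfolding sum.distrib A_def using fX fG by (simp add: sum_distrib_left)
  finally have 1: "card X * card X \<le> 2 * card A + 2 * card X" by simp
  have "1 * card A \<le> 16 * card lines"
  proof (rule card_le_fibres[where f = "\<lambda>p. line (fst p) (snd p)"])
    show "finite A" using fX fG by (simp add: A_def)
    show "finite lines" by (rule finite_lines)
    show "(\<lambda>p. line (fst p) (snd p)) ` A \<subseteq> lines"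
      using A inV by (force intro: line_in_lines)
  next
    fix L
    define S where "S = {p \<in> A. line (fst p) (snd p) = L}"
    have "card S \<le> 16"
    proof (cases "S = {}")
      case False
      then obtain P Q where PQ: "(P, Q) \<in> S" by auto
      then have m: "(P, Q) \<in> A" by (simp add: S_def)
      define Z where "Z = {P, bar P, Q, bar Q}"
      have "S \<subseteq> Z \<times> Z"
      proof
        fix p assume p: "p \<in> S"
        obtain P' Q' where p': "p = (P', Q')" by fastforce
        have m': "(P', Q') \<in> A" using p p' by (simp add: S_def)
        have L: "line P Q = line P' Q'" using PQ p p' by (simp add: S_def)
        then have L': "line P Q = line Q' P'" using line_commute A(3,4)[OF m'] inV by auto
        have "P' \<in> Z" "Q' \<in> Z"
          using distance_two_lines_differ[OF A(1,2)[OF m] A(1,2)[OF m'] A(5)[OF m] A(5)[OF m'] L]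
            distance_two_lines_differ[OF A(1,2)[OF m] A(2,1)[OF m'] A(5)[OF m] _ L']
            A(5)[OF m'] sym[of P' Q'] by (auto simp: Z_def)
        then show "p \<in> Z \<times> Z" using p' by simp
      qed
      then have "card S \<le> card (Z \<times> Z)" by (intro card_mono) (auto simp: Z_def)
      also have "\<dots> = card Z * card Z" by (rule card_cartesian_product)
      also have "\<dots> \<le> 4 * 4" unfolding Z_def by (intro mult_le_mono card_quadruple_le)
      finally show ?thesis by simp
    qed simp
    then show "1 * card {p \<in> A. line (fst p) (snd p) = L} \<le> 16" by (simp add: S_def)
  qed
  then have "card X * card X \<le> 32 * card lines + 2 * card X" using 1 by linarith
  moreover have "4 * card X \<le> card X * card X" using False by (intro mult_le_mono1) simp
  ultimately show ?thesis unfolding power2_eq_square by linarith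
qed

end

context diameter_two_part
begin

text \<open>The line fixes \<open>sym_diff (nonadj a) (nonadj b)\<close>, so \<open>a\<close>
  determines \<open>nonadj b\<close> and, among representatives, \<open>b\<close> itself. The pairs
  thus form a matching whose ends are a complementary family.\<close>

lemma matching_card:
  assumes R: "R \<subseteq> U" "inj_on nonadj R"
    and F: "F = {(a, b). a \<in> R \<and> b \<in> R - nonadj a \<and> line a b = L}"
  shows "card F ^ 2 \<le> 64 * card lines"
proof -
  define X where "X = fst ` F"
  have Fp: "a \<in> R" "b \<in> R" "a \<in> U" "b \<in> U" "b \<notin> nonadj a" "line a b = L" if "(a, b) \<in> F" for a b
    using that F R by auto
  have FL: "L \<inter> U = sym_diff (nonadj a) (nonadj b)" if "(a, b) \<in> F" for a b
    using adjacent_line[OF Fp(3-5)[OF that]] Fp(6)[OF that] by simp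
  have uniq: "b = b'" if "(a, b) \<in> F" "(a, b') \<in> F" for a b b'
  proof -
    have "nonadj b = nonadj b'" using FL[OF that(1)] FL[OF that(2)] by blast
    then show ?thesis using R(2) Fp(2)[OF that(1)] Fp(2)[OF that(2)] by (simp add: inj_on_def)
  qed
  have swap: "(b, a) \<in> F" if "(a, b) \<in> F" for a b
    using Fp[OF that] F nonadj_sym[of a b] line_commute[of a b] inV by auto
  define bar where "bar a = (THE b. (a, b) \<in> F)" for a
  have bar: "bar a = b" if "(a, b) \<in> F" for a b
    unfolding bar_def using that uniq by blast
  have barF: "(a, bar a) \<in> F" if "a \<in> X" for a
    using that bar by (force simp: X_def)
  interpret complementary_family V \<delta> U X bar
  proof unfold_locales
    show "X \<subseteq> U" using Fp by (auto simp: X_def)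
    show "bar P \<in> X" if "P \<in> X" for P using swap[OF barF[OF that]] by (force simp: X_def)
    show "bar (bar P) = P" if "P \<in> X" for P using bar[OF swap[OF barF[OF that]]] .
    show "Q \<in> nonadj P \<longleftrightarrow> Q \<notin> nonadj (bar P)" if "P \<in> X" "Q \<in> X" for P Q
    proof -
      have "Q \<in> U" using Fp(3)[OF barF[OF that(2)]] .
      moreover have "Q \<in> L"
        using Fp(3,4,6)[OF barF[OF that(2)]] ends_in_line inV by metis
      ultimately show ?thesis using FL[OF barF[OF that(1)]] by blast
    qed
  qed
  have "inj_on fst F" using uniq by (auto simp: inj_on_def)
  then have "card X = card F" by (simp add: X_def card_image)
  then show ?thesis using complementary_card by simp
qed

text \<open>Classes of size at most two leave \<open>n / 8\<close> representatives, hence at least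
  \<open>n ^ 2 / 128\<close> ordered adjacent pairs among them; each line takes at most
  \<open>s\<close> of these, where \<open>s ^ 2 \<le> 64 * m\<close>.\<close>

lemma few_twins_bound:
  assumes W: "W = {a \<in> U. card {b \<in> U. nonadj b = nonadj a} \<le> 2}"
    and n: "32 \<le> n" "n \<le> 4 * card W"
    and small: "\<And>a. a \<in> U \<Longrightarrow> 32 * card (nonadj a) \<le> n + 32"
  shows "n ^ 4 \<le> 1048576 * card lines ^ 3"
proof -
  define m where "m = card lines"
  have WU: "W \<subseteq> U" and finW: "finite W" using W finU by auto
  obtain R where R: "R \<subseteq> W" "inj_on nonadj R" "nonadj ` W = nonadj ` R"
    using subset_image_inj[of "nonadj ` W" nonadj W] by auto
  have cR: "card (nonadj ` W) = card R" using R card_image by metis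
  have RU: "R \<subseteq> U" using R WU by auto
  have finR: "finite R" using R finW finite_subset by blast
  have "1 * card W \<le> 2 * card (nonadj ` W)"
  proof (rule card_le_fibres[where f = nonadj])
    fix y assume "y \<in> nonadj ` W"
    then obtain a where a: "a \<in> W" "y = nonadj a" by auto
    have "card {b \<in> W. nonadj b = y} \<le> card {b \<in> U. nonadj b = nonadj a}"
      using a WU finU by (intro card_mono) auto
    also have "\<dots> \<le> 2" using a W by auto
    finally show "1 * card {b \<in> W. nonadj b = y} \<le> 2" by simp
  qed (use finW in auto)
  then have R8: "n \<le> 8 * card R" using n cR by linarith
  define A where "A = Sigma R (\<lambda>a. R - nonadj a)"
  have finA: "finite A" using finR by (simp add: A_def)
  define f where "f p = line (fst p) (snd p)" for p
  have fA: "f ` A \<subseteq> lines"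
  proof
    fix L assume "L \<in> f ` A"
    then obtain p where "p \<in> A" "L = f p" by auto
    then have ab: "fst p \<in> U" "snd p \<in> U" "snd p \<notin> nonadj (fst p)" "L = line (fst p) (snd p)"
      using RU by (auto simp: A_def f_def)
    then have "fst p \<noteq> snd p" using self_nonadj by auto
    then show "L \<in> lines" using ab inV line_in_lines by auto
  qed
  have n1: "card R * n \<le> 16 * card A"
    unfolding A_def using many_adjacent_pairs[OF RU n(1) R8 small] .
  have "card R * n > 0" using n R8 by (intro mult_pos_pos) linarith+
  then have "A \<noteq> {}" using n1 by auto
  then have ne: "lines \<noteq> {}" using fA by auto
  define s where "s = Max ((\<lambda>L. card {p \<in> A. f p = L}) ` lines)"
  have "s \<in> (\<lambda>L. card {p \<in> A. f p = L}) ` lines"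
    unfolding s_def using finite_lines ne by (intro Max_in) auto
  then obtain L where L: "s = card {p \<in> A. f p = L}" by auto
  have s2: "s ^ 2 \<le> 64 * m"
    unfolding L m_def
    by (rule matching_card[OF RU R(2), where L = L]) (auto simp: A_def f_def)
  have "1 * card A \<le> s * card lines"
  proof (rule card_le_fibres[OF finA finite_lines fA])
    show "1 * card {p \<in> A. f p = L} \<le> s" if "L \<in> lines" for L
      unfolding s_def using finite_lines that by (auto intro!: Max_ge)
  qed
  then have A1: "card A \<le> s * m" by (simp add: m_def)
  have "n * n \<le> (8 * card R) * n" using R8 by (rule mult_le_mono1)
  also have "\<dots> = 8 * (card R * n)" by simp
  also have "\<dots> \<le> 128 * (s * m)" using n1 A1 by linarith
  finally have "(n * n) ^ 2 \<le> (128 * (s * m)) ^ 2" by (intro power_mono) auto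
  also have "\<dots> = 16384 * m ^ 2 * s ^ 2" by (simp add: power_mult_distrib)
  also have "\<dots> \<le> 16384 * m ^ 2 * (64 * m)" using s2 by (rule mult_le_mono2)
  finally show ?thesis
    unfolding m_def by (simp add: power2_eq_square power3_eq_cube power4_eq_xxxx mult_ac)
qed

end

section \<open>Combining few and many far pairs\<close>

context geodesic_space
begin

text \<open>At most half of the points have more than \<open>n / 32\<close> points at distance 2 or
  more. Any two of the remaining points have a point of \<open>V\<close> within distance 1 of both,
  so they form a part of diameter two.\<close>

lemma few_far_pairs_bound:
  assumes n: "32 \<le> card V"
    and far: "64 * card (Sigma V (\<lambda>a. {b \<in> V. 2 \<le> \<delta> a b})) \<le> card V ^ 2"
  shows "card V ^ 4 \<le> 1048576 * card lines ^ 3"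
proof -
  define H where "H a = {b \<in> V. 2 \<le> \<delta> a b}" for a
  define n where "n = card V"
  define U where "U = {a \<in> V. 32 * card (H a) \<le> n}"
  have fH: "finite (H a)" for a using finV by (simp add: H_def)
  have UV: "U \<subseteq> V" by (auto simp: U_def)
  have "card (V - U) * n = (\<Sum>a\<in>V - U. n)" by simp
  also have "\<dots> \<le> (\<Sum>a\<in>V - U. 32 * card (H a))" by (intro sum_mono) (auto simp: U_def)
  also have "\<dots> \<le> (\<Sum>a\<in>V. 32 * card (H a))" using finV by (intro sum_mono2) auto
  also have "\<dots> = 32 * card (Sigma V H)" using finV fH by (simp add: sum_distrib_left)
  finally have "2 * (card (V - U) * n) \<le> n * n"
    using far unfolding H_def n_def power2_eq_square by linarith
  then have "(2 * card (V - U)) * n \<le> n * n" by simp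
  then have "2 * card (V - U) \<le> n" using n by (simp add: n_def)
  moreover have "n = card U + card (V - U)"
    unfolding n_def using finV UV
    by (subst card_Un_disjoint[symmetric]) (auto intro: arg_cong[of _ _ card] finite_subset)
  ultimately have U2: "n \<le> 2 * card U" by linarith
  interpret diameter_two_part V \<delta> U
  proof unfold_locales
    fix a b assume ab: "a \<in> U" "b \<in> U"
    have "\<not> V \<subseteq> H a \<union> H b \<union> {a, b}"
    proof
      assume "V \<subseteq> H a \<union> H b \<union> {a, b}"
      then have "n \<le> card (H a \<union> H b \<union> {a, b})" unfolding n_def using fH by (intro card_mono) auto
      moreover have "card (H a \<union> H b \<union> {a, b}) \<le> card (H a) + card (H b) + 2"
        using card_Un_le[of "H a \<union> H b" "{a, b}"] card_Un_le[of "H a" "H b"] card_pair_le[of a b]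
        by linarith
      ultimately show False using n ab by (simp add: U_def n_def)
    qed
    then obtain u where "u \<in> V" "\<not> 2 \<le> \<delta> a u" "\<not> 2 \<le> \<delta> b u" by (auto simp: H_def)
    then show "\<delta> a b \<le> 2" using tri[of a u b] subsetD[OF UV ab(1)] subsetD[OF UV ab(2)] sym[of u b]
      by auto
  qed (rule UV)
  \<comment> \<open>\<open>nonadj a\<close> contains \<open>a\<close> while \<open>H a\<close> does
    not, which costs the additional 32.\<close>
  have small: "32 * card (nonadj a) \<le> n + 32" if "a \<in> U" for a
  proof -
    have "nonadj a \<subseteq> insert a (H a)"
    proof
      fix u assume "u \<in> nonadj a"
      then have u: "u \<in> U" "\<delta> a u \<noteq> 1" by (auto simp: nonadj_def)
      then have "u = a \<or> 2 \<le> \<delta> a u" using zero[OF inV inV, OF that u(1)] by (cases "u = a") auto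
      then show "u \<in> insert a (H a)" using u(1) UV by (auto simp: H_def)
    qed
    then have "card (nonadj a) \<le> card (insert a (H a))" using fH by (intro card_mono) auto
    also have "\<dots> \<le> Suc (card (H a))" by (rule card_insert_le_m1) auto
    finally have "card (nonadj a) \<le> Suc (card (H a))" .
    moreover have "32 * card (H a) \<le> n" using that by (simp add: U_def)
    ultimately show ?thesis by linarith
  qed
  define T where "T = {a \<in> U. 3 \<le> card {b \<in> U. nonadj b = nonadj a}}"
  define W where "W = {a \<in> U. card {b \<in> U. nonadj b = nonadj a} \<le> 2}"
  have "U = T \<union> W" by (auto simp: T_def W_def)
  then have "card U \<le> card T + card W" using card_Un_le by simp
  then consider "n \<le> 4 * card T" | "n \<le> 4 * card W" using U2 by linarith
  then have "n ^ 4 \<le> 1048576 * card lines ^ 3"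
  proof cases
    case 1
    have "n ^ 4 \<le> 147456 * card lines ^ 3"
      by (rule many_twins_bound[OF T_def _ 1 small]) (use n in \<open>auto simp: n_def\<close>)
    then show ?thesis by linarith
  next
    case 2
    show ?thesis
      by (rule few_twins_bound[OF W_def _ 2 small]) (use n in \<open>auto simp: n_def\<close>)
  qed
  then show ?thesis by (simp add: n_def)
qed

text \<open>With many far pairs, \<open>far_pairs_card\<close> is applied to each distance. Two of
  the four factors \<open>D + 1\<close> come from that bound, the other two from squaring the number
  of distances.\<close>

lemma fourth_power_bound:
  assumes n: "32 \<le> card V" and diam: "\<And>x y. x \<in> V \<Longrightarrow> y \<in> V \<Longrightarrow> \<delta> x y \<le> D"
  shows "card V ^ 4 \<le> 1048576 * (D + 1) ^ 4 * card lines ^ 3"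
proof (cases "64 * card (Sigma V (\<lambda>a. {b \<in> V. 2 \<le> \<delta> a b})) \<le> card V ^ 2")
  case True
  have "card V ^ 4 \<le> 1048576 * 1 * card lines ^ 3"
    using few_far_pairs_bound[OF n True] by simp
  also have "\<dots> \<le> 1048576 * (D + 1) ^ 4 * card lines ^ 3"
    by (intro mult_le_mono) auto
  finally show ?thesis .
next
  case False
  define A where "A = Sigma V (\<lambda>a. {b \<in> V. 2 \<le> \<delta> a b})"
  define P where "P d = {(a, b). a \<in> V \<and> b \<in> V \<and> \<delta> a b = d}" for d
  define m where "m = card lines"
  have finA: "finite A" using finV by (simp add: A_def)
  have "A \<noteq> {}" using False by (auto simp: A_def)
  then obtain a b where "a \<in> V" "b \<in> V" "2 \<le> \<delta> a b" by (auto simp: A_def)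
  then have "line a b \<in> lines" using refl0 line_in_lines by force
  then have m0: "1 \<le> m" using finite_lines by (auto simp: m_def Suc_le_eq card_gt_0_iff)
  define B where "B = 80 * (D + 1) ^ 2 * m ^ 3"
  have P2: "card (P d) ^ 2 \<le> B" if "2 \<le> d" for d
  proof -
    have "card (P d) ^ 2 \<le> 16 * (D + 1) ^ 2 * (4 * m + 1) * m ^ 2"
      unfolding m_def by (rule far_pairs_card[OF that diam P_def])
    also have "\<dots> \<le> 16 * (D + 1) ^ 2 * (5 * m) * m ^ 2" using m0 by (intro mult_le_mono) auto
    finally show ?thesis by (simp add: B_def power2_eq_square power3_eq_cube mult_ac)
  qed
  \<comment> \<open>The range up to \<open>D + 2\<close> is nonempty for every \<open>D\<close> and
    has exactly \<open>D + 1\<close> elements.\<close>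
  define s where "s = Max ((\<lambda>d. card (P d)) ` {2..D + 2})"
  have "s \<in> (\<lambda>d. card (P d)) ` {2..D + 2}" unfolding s_def by (intro Max_in) auto
  then have s2: "s ^ 2 \<le> B" using P2 by auto
  have "1 * card A \<le> s * card {2..D + 2}"
  proof (rule card_le_fibres[OF finA, where f = "\<lambda>p. \<delta> (fst p) (snd p)"])
    show "(\<lambda>p. \<delta> (fst p) (snd p)) ` A \<subseteq> {2..D + 2}" using diam by (force simp: A_def)
    fix d assume d: "d \<in> {2..D + 2}"
    have "{p \<in> A. \<delta> (fst p) (snd p) = d} \<subseteq> P d" by (auto simp: A_def P_def)
    moreover have "finite (P d)"
      by (rule finite_subset[of _ "V \<times> V"]) (use finV in \<open>auto simp: P_def\<close>)
    ultimately have "card {p \<in> A. \<delta> (fst p) (snd p) = d} \<le> card (P d)" by (intro card_mono)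
    also have "\<dots> \<le> s" unfolding s_def using d by (intro Max_ge) auto
    finally show "1 * card {p \<in> A. \<delta> (fst p) (snd p) = d} \<le> s" by simp
  qed simp
  then have "card A \<le> s * (D + 1)" by simp
  then have "card V ^ 2 \<le> 64 * (s * (D + 1))" using False unfolding A_def by linarith
  then have "(card V ^ 2) ^ 2 \<le> (64 * (s * (D + 1))) ^ 2" by (intro power_mono) auto
  also have "\<dots> = 4096 * (D + 1) ^ 2 * s ^ 2"
    by (simp add: power2_eq_square algebra_simps)
  also have "\<dots> \<le> 4096 * (D + 1) ^ 2 * B" using s2 by (rule mult_le_mono2)
  also have "\<dots> = 327680 * ((D + 1) ^ 2 * (D + 1) ^ 2) * m ^ 3" by (simp add: B_def)
  also have "(D + 1) ^ 2 * (D + 1) ^ 2 = (D + 1) ^ 4" by (simp flip: power_add)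
  also have "327680 * (D + 1) ^ 4 * m ^ 3 \<le> 1048576 * (D + 1) ^ 4 * m ^ 3"
    by (intro mult_le_mono) auto
  finally show ?thesis unfolding m_def power_mult[symmetric] by simp
qed

end

section \<open>Graph metrics\<close>

lemma graph_dist_le:
  assumes "path_between V E u p v"
  shows "graph_dist V E u v \<le> length p - 1"
  unfolding graph_dist_def
  by (rule Least_le) (use assms in \<open>auto simp: path_between_def\<close>)

lemma path_between_rev: "path_between V E u p v \<longleftrightarrow> path_between V E v (rev p) u"
  by (auto simp: path_between_def hd_rev last_rev successively_rev insert_commute)

lemma graph_dist_sym: "graph_dist V E u v = graph_dist V E v u"
  unfolding graph_dist_def
  by (rule arg_cong[of _ _ Least]) (metis path_between_rev length_rev)

locale finite_connected_graph =
  fixes V :: "'a set" and E :: "'a set set"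
  assumes conn: "connected_graph V E"
begin

abbreviation dist_graph :: "'a \<Rightarrow> 'a \<Rightarrow> nat" where
  "dist_graph \<equiv> graph_dist V E"

lemma shortest_path:
  assumes "u \<in> V" "v \<in> V"
  obtains p where "path_between V E u p v" "length p = Suc (dist_graph u v)"
proof -
  obtain q where q: "path_between V E u q v" using conn assms unfolding connected_graph_def by blast
  then have "length q = Suc (length q - 1)" by (auto simp: path_between_def)
  then have "\<exists>k p. path_between V E u p v \<and> length p = Suc k" using q by blast
  from LeastI_ex[OF this] show ?thesis using that by (auto simp: graph_dist_def)
qed

lemma dist_zero:
  assumes "x \<in> V" "y \<in> V"
  shows "dist_graph x y = 0 \<longleftrightarrow> x = y"
proof
  assume "dist_graph x y = 0"
  then obtain p where "path_between V E x p y" "length p = 1"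
    using shortest_path[OF assms] by auto
  then show "x = y" by (auto simp: path_between_def length_Suc_conv)
next
  assume "x = y"
  then show "dist_graph x y = 0"
    using graph_dist_le[of V E x "[x]" y] assms by (simp add: path_between_def)
qed

text \<open>Paths have distinct vertices, so \<open>u\<close> can be prepended only if it is not on
  \<open>p\<close>; otherwise the part of \<open>p\<close> starting at \<open>u\<close> is short
  enough.\<close>

lemma dist_edge_le:
  assumes V: "u \<in> V" "v \<in> V" "w \<in> V" and e: "{u, v} \<in> E"
  shows "dist_graph u w \<le> 1 + dist_graph v w"
proof -
  obtain p where p: "path_between V E v p w" "length p = Suc (dist_graph v w)"
    using shortest_path[OF V(2,3)] .
  show ?thesis
  proof (cases "u \<in> set p")
    case False
    have "path_between V E u (u # p) w"
      using p(1) e V False by (auto simp: path_between_def successively_Cons)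
    then show ?thesis using graph_dist_le[of V E u "u # p" w] p(2) by simp
  next
    case True
    then obtain ys zs where split: "p = ys @ u # zs" by (meson in_set_conv_decomp)
    have "path_between V E u (u # zs) w"
      using p(1) by (auto simp: path_between_def split successively_append_iff)
    then show ?thesis using graph_dist_le[of V E u "u # zs" w] p(2) split by simp
  qed
qed

text \<open>The second vertex of a shortest path serves: the rest of the path bounds its distance to
  \<open>y\<close> from above, and \<open>dist_edge_le\<close> from below.\<close>

lemma dist_step:
  assumes V: "x \<in> V" "y \<in> V" and ne: "x \<noteq> y"
  obtains u where "u \<in> V" "{x, u} \<in> E" "dist_graph x u = 1" "dist_graph x y = 1 + dist_graph u y"
proof -
  obtain p where p: "path_between V E x p y" "length p = Suc (dist_graph x y)"
    using shortest_path[OF V] .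
  obtain q where q: "p = x # q" "q \<noteq> []"
    using p(1) ne by (cases p) (auto simp: path_between_def split: if_splits)
  define u where "u = hd q"
  have u: "u \<in> V" "{x, u} \<in> E" "x \<noteq> u" and uy: "path_between V E u q y"
    using p(1) q by (auto simp: path_between_def successively_Cons u_def)
  have "dist_graph u y \<le> length q - 1" by (rule graph_dist_le[OF uy])
  moreover have "dist_graph x y \<le> 1 + dist_graph u y" by (rule dist_edge_le[OF V(1) u(1) V(2) u(2)])
  ultimately have 1: "dist_graph x y = 1 + dist_graph u y" using p(2) q by (cases q) auto
  have "dist_graph x u \<le> 1 + dist_graph u u" by (rule dist_edge_le[OF V(1) u(1) u(1) u(2)])
  moreover have "dist_graph u u = 0" "dist_graph x u \<noteq> 0" using dist_zero u V by auto
  ultimately have "dist_graph x u = 1" by simp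
  then show ?thesis using that u 1 by blast
qed

text \<open>Induction along a geodesic from \<open>x\<close> to \<open>y\<close> avoids joining two
  paths, which need not keep the vertices distinct.\<close>

lemma dist_triangle:
  assumes "x \<in> V" "y \<in> V" "z \<in> V"
  shows "dist_graph x z \<le> dist_graph x y + dist_graph y z"
  using assms(1)
proof (induction "dist_graph x y" arbitrary: x)
  case 0
  then show ?case using dist_zero[of x y] assms by simp
next
  case (Suc n)
  then have "x \<noteq> y" using dist_zero[of x y] assms by auto
  then obtain u where u: "u \<in> V" "{x, u} \<in> E" "dist_graph x y = 1 + dist_graph u y"
    using dist_step[OF Suc.prems assms(2)] by blast
  have "dist_graph u z \<le> dist_graph u y + dist_graph y z"
    by (rule Suc.hyps(1)) (use Suc.hyps(2) u in auto)
  then show ?case using dist_edge_le[OF Suc.prems u(1) assms(3) u(2)] u(3) by linarith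
qed

sublocale geodesic_space V dist_graph
proof unfold_locales
  show "finite V" using conn by (simp add: connected_graph_def)
  show "\<exists>u\<in>V. dist_graph x u = 1 \<and> dist_graph x y = 1 + dist_graph u y"
    if "x \<in> V" "y \<in> V" "x \<noteq> y" for x y
    using dist_step[OF that] by metis
qed (use dist_zero graph_dist_sym dist_triangle in auto)

lemma dist_le_diameter:
  assumes "x \<in> V" "y \<in> V"
  shows "dist_graph x y \<le> graph_diameter V E"
proof -
  have "{dist_graph u v | u v. u \<in> V \<and> v \<in> V} = (\<lambda>(u, v). dist_graph u v) ` (V \<times> V)" by auto
  then have "finite {dist_graph u v | u v. u \<in> V \<and> v \<in> V}" using finV by simp
  then show ?thesis unfolding graph_diameter_def using assms by (intro Max_ge) auto
qed

end

theorem mainTheorem8: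
  fixes D :: nat
  shows "\<exists>c::real. c > 0 \<and> (\<exists>N::nat. \<forall>n\<ge>N. \<forall>(V :: 'a set) E.
           connected_graph V E \<and> card V = n \<and> graph_diameter V E = D \<longrightarrow>
           real (card (metric_lines V (graph_metric V E))) \<ge> c * real n powr (4 / 3))"
proof -
  define K :: nat where "K = 1048576 * (D + 1) ^ 4"
  have K: "real K > 0" by (simp add: K_def)
  \<comment> \<open>The constant comes from taking cube roots in
    \<open>n ^ 4 \<le> K * m ^ 3\<close>; 32 is the least size that
    \<open>fourth_power_bound\<close> admits.\<close>
  show ?thesis
  proof (intro exI[of _ "real K powr (- 1 / 3)"] conjI exI[of _ 32] allI impI)
    show "real K powr (- 1 / 3) > 0" using K by simp
  next
    fix n :: nat and V :: "'a set" and E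
    assume n: "32 \<le> n" and G: "connected_graph V E \<and> card V = n \<and> graph_diameter V E = D"
    interpret finite_connected_graph V E using G by unfold_locales simp
    define m where "m = card (metric_lines V (graph_metric V E))"
    have metric: "graph_metric V E = (\<lambda>x y. real (dist_graph x y))"
      by (intro ext) (simp add: graph_metric_def)
    have "n ^ 4 \<le> K * m ^ 3"
      using fourth_power_bound[of D] dist_le_diameter G n by (simp add: K_def m_def metric)
    then have "real (n ^ 4) \<le> real (K * m ^ 3)" by (simp only: of_nat_le_iff)
    then have le: "real n ^ 4 \<le> real K * real m ^ 3" by simp
    have n0: "real n > 0" using n by simp
    have "m \<noteq> 0" using le n0 by (cases "m = 0") auto
    then have m0: "real m > 0" by simp
    have "real n powr (4 / 3) = (real n ^ 4) powr (1 / 3)"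
      using n0 by (simp add: powr_powr flip: powr_numeral)
    also have "\<dots> \<le> (real K * real m ^ 3) powr (1 / 3)"
      using le n0 by (intro powr_mono2) auto
    also have "\<dots> = real K powr (1 / 3) * real m"
      using K m0 by (simp add: powr_mult powr_powr flip: powr_numeral)
    finally have "real K powr (- 1 / 3) * real n powr (4 / 3)
        \<le> real K powr (- 1 / 3) * (real K powr (1 / 3) * real m)"
      by (intro mult_left_mono) auto
    also have "\<dots> = (real K powr (- 1 / 3) * real K powr (1 / 3)) * real m" by simp
    also have "real K powr (- 1 / 3) * real K powr (1 / 3) = 1"
      using K by (simp flip: powr_add)
    finally show "real (card (metric_lines V (graph_metric V E))) \<ge> real K powr (- 1 / 3) * real n powr (4 / 3)"
      by (simp add: m_def)
  qed
qed

end
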